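(* Let $\delta>0$, $\eta>0$, $n=\lceil\delta\rceil$, and let $\nu\in(0,1)$ be such that $\nu r\in(0,1)$ for all $r=1,\dots,n$. Then the $\mathfrak{G}$-adapted process ${}_\eta\mathfrak{V}_t^{\nu,\delta}={}_\eta\mathcal{V}^{\nu,n}_{\mathscr{V}_t^{\delta/n}}$, $t\ge 0$, is a subordinator. Furthermore, its associated Lévy measure is $$m(\mathrm dx)=\int_0^\infty e^{-\eta^n t}\,\mathbb{P}\left({}_\eta\mathcal{V}_t^{\nu,n}\in \mathrm dx\right)\frac{\delta}{n}\,\frac{t^{-\left(1+\frac{\delta}{n}\right)}}{\Gamma\left(1-\frac{\delta}{n}\right)}\,\mathrm dt .$$
   Context: Let $(\Omega,\mathcal{F},\mathfrak{F},\mathbb{P})$ be a filtered probability space with right-continuous filtration $\mathfrak{F}=(\mathcal{F}_t)_{t\ge0}$. A subordinator is an adapted stochastic process $S_t$, $t\ge0$, starting from zero, with increasing paths and with independent and stationary increments (and infinite lifetime). Its Laplace exponent $\Phi$ is defined by $\mathbb{E}e^{-\mu S_t}=e^{-t\Phi(\mu)}$, $\mu\ge 0$, and can be written uniquely as $\Phi(\mu)=b\mu+\int_0^\infty(1-e^{-\mu x})\,m(\mathrm dx)$ with drift $b\ge0$ and a measure $m$ concentrated on $(0,\infty)$ with $\int_0^\infty(1\wedge x)\,m(\mathrm dx)<\infty$; $m$ is called the Lévy measure. For $\beta\in(0,1)$, a $\beta$-stable subordinator $V^\beta_t$ is a subordinator with $\mathbb{E}e^{-\mu V_t^\beta}=e^{-t\mu^\beta}$.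 For $n\in\mathbb{N}$, $\eta>0$ and $\nu r\in(0,1)$, $r=1,\dots,n$, let $V^{\nu r}_t$, $r=1,\dots,n$, be $\mathfrak{F}$-adapted independent $\nu r$-stable subordinators and define $${}_\eta\mathcal{V}_t^{\nu,n}=\sum_{r=1}^n\binom{n}{r}^{\frac1{\nu r}}\eta^{\frac{n-r}{\nu r}}V_t^{\nu r},\qquad t\ge0 .$$ For $\delta>0$ with $\lceil\delta\rceil=n$, let $\mathscr{V}_t^{\delta/n}$, $t\ge 0$, be the $\mathfrak{F}$-adapted tempered $\delta/n$-stable subordinator with tempering parameter $\eta^n$, i.e. with Laplace exponent $\Phi(\mu)=(\eta^n+\mu)^{\delta/n}-\eta^\delta$, independent of the $V^{\nu r}$, $r=1,\dots,n$. The process ${}_\eta\mathfrak{V}_t^{\nu,\delta}$ is the time-change ${}_\eta\mathfrak{V}_t^{\nu,\delta}={}_\eta\mathcal{V}^{\nu,n}_{\mathscr{V}_t^{\delta/n}}$, and $\mathfrak{G}=(\mathcal{G}_t)_{t\ge0}=\bigl(\mathcal{F}_{\mathscr{V}_t^{\delta/n}}\bigr)_{t\ge0}$ is the subordinated filtration.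
   Formalization: The Lévy measure formula is stated only for non-integer δ (δ<n), since for δ=n it contains 1/Γ(0) and is undefined; the subordinator claim covers all δ>0. Subordinators have right-continuous paths, as is standard. *)

theory Defs
  imports "HOL-Probability.Probability"
begin

text \<open>Time is \<open>[0,\<infinity>)\<close>, embedded in \<^typ>\<open>real\<close>: processes are functions
  \<open>S :: real \<Rightarrow> 'a \<Rightarrow> real\<close> of which only the values \<open>S t\<close> with \<open>t \<ge> 0\<close> matter.  The library
  locale \<^locale>\<open>filtration\<close> also asks for monotonicity at negative times; this is no
  restriction, as \<open>F\<close> can be extended by \<open>F t = F 0\<close> for \<open>t < 0\<close>.\<close>

definition filtered_prob_space :: "'a measure \<Rightarrow> (real \<Rightarrow> 'a measure) \<Rightarrow> bool" where
  "filtered_prob_space M F \<longleftrightarrow>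
     prob_space M \<and> filtration (space M) F \<and> (\<forall>t. sets (F t) \<subseteq> sets M) \<and>
     (\<forall>t\<ge>0. sets (F t) = (\<Inter>u\<in>{t<..}. sets (F u)))"

definition adapted :: "(real \<Rightarrow> 'a measure) \<Rightarrow> (real \<Rightarrow> 'a \<Rightarrow> real) \<Rightarrow> bool" where
  "adapted F S \<longleftrightarrow> (\<forall>t\<ge>0. S t \<in> borel_measurable (F t))"

definition independent_increments :: "'a measure \<Rightarrow> (real \<Rightarrow> 'a \<Rightarrow> real) \<Rightarrow> bool" where
  "independent_increments M S \<longleftrightarrow>
     (\<forall>(k::nat) t. 0 \<le> t 0 \<and> incseq t \<longrightarrow>
        prob_space.indep_vars M (\<lambda>_. borel) (\<lambda>i \<omega>. S (t (Suc i)) \<omega> - S (t i) \<omega>) {..<k})"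

definition stationary_increments :: "'a measure \<Rightarrow> (real \<Rightarrow> 'a \<Rightarrow> real) \<Rightarrow> bool" where
  "stationary_increments M S \<longleftrightarrow>
     (\<forall>s\<ge>0. \<forall>t\<ge>0. distr M borel (\<lambda>\<omega>. S (s + t) \<omega> - S s \<omega>) = distr M borel (S t))"

text \<open>Paths are right-continuous, as is part of the standard notion of a Levy process; without
  it \<open>S\<close> evaluated at a random time need not even be measurable.\<close>

definition subordinator ::
    "'a measure \<Rightarrow> (real \<Rightarrow> 'a measure) \<Rightarrow> (real \<Rightarrow> 'a \<Rightarrow> real) \<Rightarrow> bool" where
  "subordinator M F S \<longleftrightarrow>
     adapted F S \<and>
     (\<forall>\<omega>\<in>space M. S 0 \<omega> = 0 \<and> mono_on {0..} (\<lambda>t. S t \<omega>) \<and>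
        (\<forall>t\<ge>0. continuous (at_right t) (\<lambda>u. S u \<omega>))) \<and>
     independent_increments M S \<and> stationary_increments M S"

definition has_laplace_exponent ::
    "'a measure \<Rightarrow> (real \<Rightarrow> 'a \<Rightarrow> real) \<Rightarrow> (real \<Rightarrow> real) \<Rightarrow> bool" where
  "has_laplace_exponent M S \<Phi> \<longleftrightarrow>
     (\<forall>t\<ge>0. \<forall>\<mu>\<ge>0. (\<integral>\<omega>. exp (- \<mu> * S t \<omega>) \<partial>M) = exp (- t * \<Phi> \<mu>))"

text \<open>The pair of drift and Levy measure is uniquely determined by the Laplace exponent, so
  this relation determines \<open>m\<close>.  The Bochner integral below is of an integrable function, by the
  moment condition.\<close>

definition is_levy_measure :: "'a measure \<Rightarrow> (real \<Rightarrow> 'a \<Rightarrow> real) \<Rightarrow> real measure \<Rightarrow> bool" where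
  "is_levy_measure M S m \<longleftrightarrow>
     sets m = sets borel \<and> emeasure m {..0} = 0 \<and>
     (\<integral>\<^sup>+x. ennreal (min 1 x) \<partial>m) < \<infinity> \<and>
     (\<exists>b\<ge>0. has_laplace_exponent M S (\<lambda>\<mu>. b * \<mu> + (\<integral>x. (1 - exp (- \<mu> * x)) \<partial>m)))"

definition stable_subordinator ::
    "'a measure \<Rightarrow> (real \<Rightarrow> 'a measure) \<Rightarrow> real \<Rightarrow> (real \<Rightarrow> 'a \<Rightarrow> real) \<Rightarrow> bool" where
  "stable_subordinator M F \<beta> S \<longleftrightarrow>
     \<beta> \<in> {0<..<1} \<and> subordinator M F S \<and> has_laplace_exponent M S (\<lambda>\<mu>. \<mu> powr \<beta>)"

definition stable_combination ::
    "real \<Rightarrow> real \<Rightarrow> nat \<Rightarrow> (nat \<Rightarrow> real \<Rightarrow> 'a \<Rightarrow> real) \<Rightarrow> real \<Rightarrow> 'a \<Rightarrow> real" where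
  "stable_combination \<eta> \<nu> n V t \<omega> =
     (\<Sum>r=1..n. real (n choose r) powr (1 / (\<nu> * real r))
        * \<eta> powr ((real n - real r) / (\<nu> * real r)) * V r t \<omega>)"

text \<open>A process as a single random variable with values in \<open>\<real>\<^bsup>[0,\<infinity>)\<^esup>\<close> with its product
  \<open>\<sigma>\<close>-algebra; independence of processes is independence of these variables.\<close>

abbreviation path_space :: "(real \<Rightarrow> real) measure" where
  "path_space \<equiv> PiM {0..} (\<lambda>_. borel)"

definition path_of :: "(real \<Rightarrow> 'a \<Rightarrow> real) \<Rightarrow> 'a \<Rightarrow> real \<Rightarrow> real" where
  "path_of S \<omega> = (\<lambda>t\<in>{0..}. S t \<omega>)"

definition cadlag_on :: "'a set \<Rightarrow> (real \<Rightarrow> 'a \<Rightarrow> real) \<Rightarrow> bool" where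
  "cadlag_on \<Omega> X \<longleftrightarrow>
     (\<forall>\<omega>\<in>\<Omega>. (\<forall>t\<ge>0. continuous (at_right t) (\<lambda>u. X u \<omega>)) \<and>
             (\<forall>t>0. \<exists>l. ((\<lambda>u. X u \<omega>) \<longlongrightarrow> l) (at_left t)))"

text \<open>The \<open>\<sigma>\<close>-algebra \<open>F\<^sub>T\<close> of a random time \<open>T\<close> that need not be a stopping time (a subordinator
  adapted to \<open>F\<close> is not, at a fixed \<open>t\<close>, an \<open>F\<close>-stopping time in general):
  it is generated by the variables \<open>X\<^sub>T\<close> with \<open>X\<close> optional, equivalently with \<open>X\<close> adapted
  and cadlag, since these generate the optional \<open>\<sigma>\<close>-algebra.  The textbook
  \<open>{A. A \<inter> {T \<le> t} \<in> F\<^sub>t for all t}\<close> is in general not a \<open>\<sigma>\<close>-algebra then; for stopping times the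
  two agree, as proved below.\<close>

definition sigma_at :: "'a measure \<Rightarrow> (real \<Rightarrow> 'a measure) \<Rightarrow> ('a \<Rightarrow> real) \<Rightarrow> 'a measure" where
  "sigma_at M F T = sigma (space M)
     {(\<lambda>\<omega>. X (T \<omega>) \<omega>) -` B \<inter> space M | X B.
        adapted F X \<and> cadlag_on (space M) X \<and> B \<in> sets borel}"

lemma measurable_at_min_stopping_time:
  fixes X :: "real \<Rightarrow> 'a \<Rightarrow> real" and F :: "real \<Rightarrow> 'a measure"
  assumes F: "filtration \<Omega> F" and T: "stopping_time F T" and T0: "\<And>\<omega>. \<omega> \<in> \<Omega> \<Longrightarrow> 0 \<le> T \<omega>"
    and X: "adapted F X" "cadlag_on \<Omega> X" and t: "0 \<le> t"
  shows "(\<lambda>\<omega>. X (min (T \<omega>) t) \<omega>) \<in> borel_measurable (F t)"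
proof -
  interpret filtration \<Omega> F by fact
  define \<tau> where "\<tau> \<omega> = min (T \<omega>) t" for \<omega>
  define u where "u k i = max 0 (min t ((real_of_int i + 1) / real (Suc k)))" for k i
  define g where "g k \<omega> = \<lfloor>real (Suc k) * \<tau> \<omega>\<rfloor>" for k \<omega>
  have \<tau>: "\<tau> \<in> borel_measurable (F t)"
  proof (rule borel_measurableI_le)
    fix c
    have "{\<omega> \<in> space (F t). \<tau> \<omega> \<le> c} =
        (if t \<le> c then space (F t) else {\<omega> \<in> space (F t). T \<omega> \<le> c})"
      by (auto simp: \<tau>_def min_le_iff_disj)
    also have "\<dots> \<in> sets (F t)"
      using stopping_time_le_const[OF T, of c t] by (auto simp: pred_def)
    finally show "{\<omega> \<in> space (F t). \<tau> \<omega> \<le> c} \<in> sets (F t)" .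
  qed
  have Xu: "X (u k i) \<in> borel_measurable (F t)" for k i
  proof -
    have "0 \<le> u k i" "u k i \<le> t" using t by (auto simp: u_def)
    then have "X (u k i) \<in> borel_measurable (F (u k i))"
      using X(1) by (auto simp: adapted_def)
    moreover have "sets (F (u k i)) \<subseteq> sets (F t)"
      using \<open>u k i \<le> t\<close> by (rule sets_F_mono)
    ultimately show ?thesis
      by (auto simp: measurable_def space_F)
  qed
  have g: "g k \<in> measurable (F t) (count_space UNIV)" for k
    unfolding g_def using \<tau> by measurable
  have meas: "(\<lambda>\<omega>. X (u k (g k \<omega>)) \<omega>) \<in> borel_measurable (F t)" for k
    by (rule measurable_compose_countable[OF Xu g])
  have "(\<lambda>k. X (u k (g k \<omega>)) \<omega>) \<longlonglongrightarrow> X (\<tau> \<omega>) \<omega>" if "\<omega> \<in> space (F t)" for \<omega>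
  proof -
    have \<omega>: "\<omega> \<in> \<Omega>" using that by (simp add: space_F)
    have \<tau>0: "0 \<le> \<tau> \<omega>" using T0[OF \<omega>] t by (simp add: \<tau>_def)
    have lo: "\<tau> \<omega> < (real_of_int (g k \<omega>) + 1) / real (Suc k)" for k
    proof -
      have "real (Suc k) * \<tau> \<omega> < real_of_int (g k \<omega>) + 1" unfolding g_def by linarith
      then show ?thesis by (simp add: pos_less_divide_eq mult.commute)
    qed
    have hi: "(real_of_int (g k \<omega>) + 1) / real (Suc k) \<le> \<tau> \<omega> + 1 / real (Suc k)" for k
    proof -
      have "real_of_int (g k \<omega>) + 1 \<le> real (Suc k) * \<tau> \<omega> + 1" unfolding g_def by linarith
      then have "(real_of_int (g k \<omega>) + 1) / real (Suc k)
          \<le> (real (Suc k) * \<tau> \<omega> + 1) / real (Suc k)"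
        by (rule divide_right_mono) simp
      also have "\<dots> = \<tau> \<omega> + 1 / real (Suc k)" by (simp add: add_divide_distrib)
      finally show ?thesis .
    qed
    show ?thesis
    proof (cases "\<tau> \<omega> < t")
      case False
      then have "\<tau> \<omega> = t" by (simp add: \<tau>_def)
      moreover have "u k (g k \<omega>) = t" for k
        using lo[of k] t \<open>\<tau> \<omega> = t\<close> by (simp add: u_def)
      ultimately show ?thesis by simp
    next
      case True
      have u_gt: "\<tau> \<omega> < u k (g k \<omega>)" for k
        using lo[of k] True by (simp add: u_def)
      have u_le: "u k (g k \<omega>) \<le> \<tau> \<omega> + 1 / real (Suc k)" for k
        using hi[of k] \<tau>0 by (auto simp: u_def)
      have "(\<lambda>k. \<tau> \<omega> + 1 / real (Suc k)) \<longlonglongrightarrow> \<tau> \<omega> + 0"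
        by (intro tendsto_intros LIMSEQ_Suc[OF lim_1_over_n])
      then have lim_hi: "(\<lambda>k. \<tau> \<omega> + 1 / real (Suc k)) \<longlonglongrightarrow> \<tau> \<omega>" by (simp only: add_0_right)
      have "(\<lambda>k. u k (g k \<omega>)) \<longlonglongrightarrow> \<tau> \<omega>"
      proof (rule tendsto_sandwich[OF _ _ tendsto_const lim_hi])
        show "\<forall>\<^sub>F k in sequentially. \<tau> \<omega> \<le> u k (g k \<omega>)"
          using u_gt by (intro always_eventually allI less_imp_le)
        show "\<forall>\<^sub>F k in sequentially. u k (g k \<omega>) \<le> \<tau> \<omega> + 1 / real (Suc k)"
          using u_le by (intro always_eventually allI)
      qed
      then have "filterlim (\<lambda>k. u k (g k \<omega>)) (at_right (\<tau> \<omega>)) sequentially"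
        unfolding filterlim_at using u_gt
        by (simp add: less_imp_neq[symmetric] order.strict_implies_not_eq)
      moreover have "((\<lambda>v. X v \<omega>) \<longlongrightarrow> X (\<tau> \<omega>) \<omega>) (at_right (\<tau> \<omega>))"
        using X(2) \<omega> \<tau>0 by (auto simp: cadlag_on_def continuous_within)
      ultimately show ?thesis by (rule filterlim_compose[rotated])
    qed
  qed
  then have "(\<lambda>\<omega>. X (\<tau> \<omega>) \<omega>) \<in> borel_measurable (F t)"
    using meas by (rule borel_measurable_LIMSEQ_real)
  then show ?thesis by (simp add: \<tau>_def)
qed

lemma sets_sigma_at_stopping_time:
  assumes F: "filtration (space M) F"
    and T: "stopping_time F T" and T0: "\<And>\<omega>. \<omega> \<in> space M \<Longrightarrow> 0 \<le> T \<omega>"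
  shows "sets (sigma_at M F T) = sets (filtration.pre_sigma (space M) F T)"
proof -
  interpret filtration "space M" F by fact
  let ?G = "{(\<lambda>\<omega>. X (T \<omega>) \<omega>) -` B \<inter> space M | X B.
        adapted F X \<and> cadlag_on (space M) X \<and> B \<in> sets borel}"
  have sets: "sets (sigma_at M F T) = sigma_sets (space M) ?G"
    unfolding sigma_at_def by (rule sets_measure_of) auto
  have sub: "?G \<subseteq> sets (pre_sigma T)"
  proof safe
    fix X and B :: "real set"
    assume X: "adapted F X" "cadlag_on (space M) X" and B: "B \<in> sets borel"
    show "(\<lambda>\<omega>. X (T \<omega>) \<omega>) -` B \<inter> space M \<in> sets (pre_sigma T)"
    proof (rule sets_pre_sigmaI[OF T])
      fix t
      show "{\<omega> \<in> (\<lambda>\<omega>. X (T \<omega>) \<omega>) -` B \<inter> space M. T \<omega> \<le> t} \<in> sets (F t)"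
      proof (cases "0 \<le> t")
        case True
        have "(\<lambda>\<omega>. X (min (T \<omega>) t) \<omega>) -` B \<inter> space (F t) \<in> sets (F t)"
          using measurable_at_min_stopping_time[OF F T T0 X True] B
          by (rule measurable_sets)
        moreover have "{\<omega> \<in> space (F t). T \<omega> \<le> t} \<in> sets (F t)"
          using stopping_timeD[OF T, of t] by (simp add: pred_def)
        ultimately have "((\<lambda>\<omega>. X (min (T \<omega>) t) \<omega>) -` B \<inter> space (F t)) \<inter>
            {\<omega> \<in> space (F t). T \<omega> \<le> t} \<in> sets (F t)"
          by (rule sets.Int)
        also have "((\<lambda>\<omega>. X (min (T \<omega>) t) \<omega>) -` B \<inter> space (F t)) \<inter>
            {\<omega> \<in> space (F t). T \<omega> \<le> t} = {\<omega> \<in> (\<lambda>\<omega>. X (T \<omega>) \<omega>) -` B \<inter> space M. T \<omega> \<le> t}"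
          by (auto simp: space_F min_def)
        finally show ?thesis .
      next
        case False
        then have *: "{\<omega> \<in> (\<lambda>\<omega>. X (T \<omega>) \<omega>) -` B \<inter> space M. T \<omega> \<le> t} = {}"
          using T0 order_trans by auto
        show ?thesis unfolding * by (rule sets.empty_sets)
      qed
    qed
  qed
  show ?thesis
  proof (rule antisym)
    show "sets (sigma_at M F T) \<subseteq> sets (pre_sigma T)"
      unfolding sets using sets.sigma_sets_subset[OF sub] by (simp add: space_pre_sigma)
  next
    show "sets (pre_sigma T) \<subseteq> sets (sigma_at M F T)"
    proof
      fix A assume A: "A \<in> sets (pre_sigma T)"
      have A_sub: "A \<subseteq> space M"
        using sets.sets_into_space[OF A] by (simp add: space_pre_sigma)
      define X :: "real \<Rightarrow> 'a \<Rightarrow> real" where "X u \<omega> = indicator {\<omega> \<in> A. T \<omega> \<le> u} \<omega>" for u \<omega>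
      have "adapted F X"
        unfolding adapted_def X_def using sets_pre_sigmaD[OF T A]
        by (auto intro!: borel_measurable_indicator)
      moreover have "cadlag_on (space M) X"
        unfolding cadlag_on_def
      proof (intro ballI conjI allI impI)
        fix \<omega> and t :: real
        have "\<forall>\<^sub>F u in at_right t. X u \<omega> = X t \<omega>"
        proof (cases "T \<omega> \<le> t")
          case True
          have "\<forall>\<^sub>F u in at_right t. t < u" by (rule eventually_at_right_less)
          then show ?thesis
            by eventually_elim (use True in \<open>auto simp: X_def indicator_def\<close>)
        next
          case False
          then have "\<forall>\<^sub>F u in at_right t. u < T \<omega>"
            by (intro eventually_at_rightI[of t "T \<omega>"]) auto
          then show ?thesis
            by eventually_elim (use False in \<open>auto simp: X_def indicator_def\<close>)
        qed
        then show "continuous (at_right t) (\<lambda>u. X u \<omega>)"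
          unfolding continuous_within by (rule tendsto_eventually)
        define l :: real where "l = (if \<omega> \<in> A \<and> T \<omega> < t then 1 else 0)"
        have "\<forall>\<^sub>F u in at_left t. X u \<omega> = l"
        proof (cases "T \<omega> < t")
          case True
          then have "\<forall>\<^sub>F u in at_left t. T \<omega> < u"
            by (intro eventually_at_leftI[of "T \<omega>" t]) auto
          then show ?thesis
            by eventually_elim (use True in \<open>auto simp: X_def l_def indicator_def\<close>)
        next
          case False
          have "\<forall>\<^sub>F u in at_left t. u < t"
            by (intro eventually_at_leftI[of "t - 1" t]) auto
          then show ?thesis
            by eventually_elim (use False in \<open>auto simp: X_def l_def indicator_def\<close>)
        qed
        then show "\<exists>l. ((\<lambda>u. X u \<omega>) \<longlongrightarrow> l) (at_left t)"
          by (auto intro: tendsto_eventually)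
      qed
      moreover have "A = (\<lambda>\<omega>. X (T \<omega>) \<omega>) -` {1} \<inter> space M"
        using A_sub by (auto simp: X_def indicator_def)
      moreover have "{1} \<in> sets (borel :: real measure)" by simp
      ultimately have "A \<in> ?G" unfolding mem_Collect_eq
        by (intro exI[of _ X] exI[of _ "{1}"] conjI)
      then show "A \<in> sets (sigma_at M F T)"
        unfolding sets by (rule sigma_sets.Basic)
    qed
  qed
qed

end

theory Submission
  imports Defs
begin

text \<open>
  Since \<open>T\<close> and \<open>S\<close> are independent, integrating a functional of both is a double integral
  over \<open>\<Omega> \<times> \<Omega>\<close>, in which \<open>T\<close> and \<open>S\<close> read different coordinates.  With the path of \<open>T\<close> frozen,
  the increments of \<open>S\<close> at the times \<open>T t\<^sub>i\<close> are independent and their laws depend only on the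
  increments of \<open>T\<close>; these are independent and stationary in turn.  The same double integral shows
  that Laplace exponents compose: \<open>S\<^sub>T\<close> has exponent \<open>\<Phi> \<circ> \<psi>\<close>.  Writing
  \<open>\<Phi> \<mu> = \<integral> (1 - e\<^bsup>-\<mu>t\<^esup>) g t dt\<close> for the tempered stable exponent and \<open>e\<^bsup>-t \<psi> \<mu>\<^esup> = E e\<^bsup>-\<mu> S t\<^esup>\<close> then
  displays the mixture of the laws of \<open>S t\<close> with density \<open>g\<close> as the Levy measure, with zero drift.
\<close>

section \<open>Joint measurability of right-continuous processes\<close>

text \<open>Rounding the time up to a grid of mesh \<open>1 / (k + 1)\<close> turns the process into
  a countable choice among measurable variables, and right-continuity carries measurability to the
  limit. The truncation \<open>max 0\<close> is there because nothing is assumed at negative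
  times.\<close>

lemma right_continuous_process_measurable:
  fixes X :: "real \<Rightarrow> 'a \<Rightarrow> real"
  assumes X: "\<And>t. 0 \<le> t \<Longrightarrow> X t \<in> borel_measurable N"
    and rc: "\<And>\<omega> t. \<omega> \<in> space N \<Longrightarrow> 0 \<le> t \<Longrightarrow> continuous (at_right t) (\<lambda>u. X u \<omega>)"
  shows "(\<lambda>p. X (max 0 (fst p)) (snd p)) \<in> borel_measurable (borel \<Otimes>\<^sub>M N)"
proof -
  define \<tau> where "\<tau> p = max 0 (fst p)" for p :: "real \<times> 'a"
  \<comment> \<open>The \<open>+ 1\<close> places the grid point strictly to the right of the time,
    so that a limit along \<open>at_right\<close> applies; \<open>max 0\<close> makes
    \<open>u k i\<close> an admissible time for every integer \<open>i\<close>, as the countable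
    choice requires.\<close>
  define u :: "nat \<Rightarrow> int \<Rightarrow> real" where "u k i = max 0 ((real_of_int i + 1) / real (Suc k))" for k i
  define g where "g k p = \<lfloor>real (Suc k) * \<tau> p\<rfloor>" for k p
  have [measurable]: "\<tau> \<in> borel_measurable (borel \<Otimes>\<^sub>M N)"
    unfolding \<tau>_def by measurable
  have g: "g k \<in> measurable (borel \<Otimes>\<^sub>M N) (count_space UNIV)" for k
    unfolding g_def by measurable
  have Xu: "(\<lambda>p. X (u k i) (snd p)) \<in> borel_measurable (borel \<Otimes>\<^sub>M N)" for k i
    by (rule measurable_compose[OF measurable_snd X]) (simp add: u_def)
  have meas: "(\<lambda>p. X (u k (g k p)) (snd p)) \<in> borel_measurable (borel \<Otimes>\<^sub>M N)" for k
    by (rule measurable_compose_countable[OF Xu g])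
  have "(\<lambda>k. X (u k (g k p)) (snd p)) \<longlonglongrightarrow> X (\<tau> p) (snd p)" if "p \<in> space (borel \<Otimes>\<^sub>M N)" for p
  proof -
    have \<omega>: "snd p \<in> space N" using that by (auto simp: space_pair_measure)
    have \<tau>0: "0 \<le> \<tau> p" by (simp add: \<tau>_def)
    have lo: "\<tau> p < (real_of_int (g k p) + 1) / real (Suc k)" for k
    proof -
      have "real (Suc k) * \<tau> p < real_of_int (g k p) + 1" unfolding g_def by linarith
      then show ?thesis by (simp add: pos_less_divide_eq mult.commute)
    qed
    have hi: "(real_of_int (g k p) + 1) / real (Suc k) \<le> \<tau> p + 1 / real (Suc k)" for k
    proof -
      have "real_of_int (g k p) + 1 \<le> real (Suc k) * \<tau> p + 1" unfolding g_def by linarith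
      then have "(real_of_int (g k p) + 1) / real (Suc k) \<le> (real (Suc k) * \<tau> p + 1) / real (Suc k)"
        by (rule divide_right_mono) simp
      also have "\<dots> = \<tau> p + 1 / real (Suc k)" by (simp add: add_divide_distrib)
      finally show ?thesis .
    qed
    have u_gt: "\<tau> p < u k (g k p)" for k
      using lo[of k] by (simp add: u_def)
    have u_le: "u k (g k p) \<le> \<tau> p + 1 / real (Suc k)" for k
      using hi[of k] \<tau>0 by (auto simp: u_def)
    have "(\<lambda>k. \<tau> p + 1 / real (Suc k)) \<longlonglongrightarrow> \<tau> p + 0"
      by (intro tendsto_intros LIMSEQ_Suc[OF lim_1_over_n])
    then have lim_hi: "(\<lambda>k. \<tau> p + 1 / real (Suc k)) \<longlonglongrightarrow> \<tau> p" by (simp only: add_0_right)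
    have "(\<lambda>k. u k (g k p)) \<longlonglongrightarrow> \<tau> p"
    proof (rule tendsto_sandwich[OF _ _ tendsto_const lim_hi])
      show "\<forall>\<^sub>F k in sequentially. \<tau> p \<le> u k (g k p)"
        using u_gt by (intro always_eventually allI less_imp_le)
      show "\<forall>\<^sub>F k in sequentially. u k (g k p) \<le> \<tau> p + 1 / real (Suc k)"
        using u_le by (intro always_eventually allI)
    qed
    then have "filterlim (\<lambda>k. u k (g k p)) (at_right (\<tau> p)) sequentially"
      unfolding filterlim_at using u_gt
      by (simp add: less_imp_neq[symmetric] order.strict_implies_not_eq)
    moreover have "((\<lambda>v. X v (snd p)) \<longlongrightarrow> X (\<tau> p) (snd p)) (at_right (\<tau> p))"
      using rc[OF \<omega> \<tau>0] by (simp add: continuous_within)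
    ultimately show ?thesis by (rule filterlim_compose[rotated])
  qed
  then have "(\<lambda>p. X (\<tau> p) (snd p)) \<in> borel_measurable (borel \<Otimes>\<^sub>M N)"
    using meas by (rule borel_measurable_LIMSEQ_real)
  then show ?thesis by (simp add: \<tau>_def)
qed

section \<open>Independence expressed through nonnegative integrals\<close>

context prob_space
begin

text \<open>The identity map, read once into \<open>N1\<close> and once into \<open>N2\<close>,
  gives two independent random variables, so the law of the diagonal map is a product measure and
  Tonelli applies.\<close>

lemma nn_integral_indep_diagonal:
  assumes N: "space N1 = space M" "space N2 = space M"
    and ind: "indep_set (sets N1) (sets N2)"
    and f: "f \<in> borel_measurable (N1 \<Otimes>\<^sub>M N2)"
  shows "(\<integral>\<^sup>+\<omega>. f (\<omega>, \<omega>) \<partial>M) = (\<integral>\<^sup>+\<omega>. \<integral>\<^sup>+\<omega>'. f (\<omega>, \<omega>') \<partial>M \<partial>M)"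
proof -
  have sub: "sets N1 \<subseteq> events" "sets N2 \<subseteq> events"
    using ind by (auto dest: indep_setD_ev1 indep_setD_ev2)
  have "(\<lambda>\<omega>. \<omega>) \<in> measurable M N" if "sets N \<subseteq> events" "space N = space M" for N
    using that by (intro measurableI) (auto simp: Int_absorb2 sets.sets_into_space)
  note id = this[OF sub(1) N(1)] this[OF sub(2) N(2)]
  \<comment> \<open>Pulling back along the identity returns the sub-\<sigma>-algebra itself, so
    independence of the two identity maps reduces to \<open>ind\<close>.\<close>
  have eq: "{(\<lambda>\<omega>. \<omega>) -` A \<inter> space M |A. A \<in> sets N} = sets N" if "space N = space M" for N
    using sets.sets_into_space[of _ N] that by (auto simp: Int_absorb2 vimage_def)
  have "indep_var N1 (\<lambda>\<omega>. \<omega>) N2 (\<lambda>\<omega>. \<omega>)"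
    unfolding indep_var_eq eq[OF N(1)] eq[OF N(2)]
    using id ind sets.sigma_sets_eq[of N1] sets.sigma_sets_eq[of N2] N by auto
  then have D: "distr M N1 (\<lambda>\<omega>. \<omega>) \<Otimes>\<^sub>M distr M N2 (\<lambda>\<omega>. \<omega>) = distr M (N1 \<Otimes>\<^sub>M N2) (\<lambda>\<omega>. (\<omega>, \<omega>))"
    by (simp add: indep_var_distribution_eq)
  interpret D2: prob_space "distr M N2 (\<lambda>\<omega>. \<omega>)" by (rule prob_space_distr) fact
  have f': "f \<in> borel_measurable (N1 \<Otimes>\<^sub>M distr M N2 (\<lambda>\<omega>. \<omega>))"
    using f by (simp cong: measurable_cong_sets)
  have f2: "(\<lambda>\<omega>'. f (\<omega>, \<omega>')) \<in> borel_measurable N2" if "\<omega> \<in> space M" for \<omega>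
    using that f N by (auto intro: measurable_Pair2)
  have "(\<integral>\<^sup>+\<omega>. f (\<omega>, \<omega>) \<partial>M) = (\<integral>\<^sup>+p. f p \<partial>distr M (N1 \<Otimes>\<^sub>M N2) (\<lambda>\<omega>. (\<omega>, \<omega>)))"
    using id by (subst nn_integral_distr) (auto intro!: f)
  also have "\<dots> = (\<integral>\<^sup>+\<omega>. \<integral>\<^sup>+\<omega>'. f (\<omega>, \<omega>') \<partial>distr M N2 (\<lambda>\<omega>. \<omega>) \<partial>distr M N1 (\<lambda>\<omega>. \<omega>))"
    unfolding D[symmetric] using f
    by (subst D2.nn_integral_fst) (auto cong: measurable_cong_sets)
  also have "\<dots> = (\<integral>\<^sup>+\<omega>. \<integral>\<^sup>+\<omega>'. f (\<omega>, \<omega>') \<partial>distr M N2 (\<lambda>\<omega>. \<omega>) \<partial>M)"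
    using id D2.borel_measurable_nn_integral_fst[OF f']
    by (subst nn_integral_distr) auto
  also have "\<dots> = (\<integral>\<^sup>+\<omega>. \<integral>\<^sup>+\<omega>'. f (\<omega>, \<omega>') \<partial>M \<partial>M)"
    by (intro nn_integral_cong nn_integral_distr id) (simp add: f2)
  finally show ?thesis .
qed

text \<open>The product formula over the full index set covers all subfamilies, since any
  \<open>B i\<close> may be the whole space. Integrals of indicators are the form in which the
  double integral delivers joint probabilities.\<close>

lemma indep_varsI_nn_integral:
  assumes I: "finite I" and X: "\<And>i. i \<in> I \<Longrightarrow> X i \<in> measurable M (N i)"
    and eq: "\<And>B. (\<And>i. i \<in> I \<Longrightarrow> B i \<in> sets (N i)) \<Longrightarrow>
      (\<integral>\<^sup>+\<omega>. (\<Prod>i\<in>I. indicator (B i) (X i \<omega>)) \<partial>M) = (\<Prod>i\<in>I. \<integral>\<^sup>+\<omega>. indicator (B i) (X i \<omega>) \<partial>M)"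
  shows "indep_vars N X I"
proof (cases "I = {}")
  case True
  then show ?thesis by (simp add: indep_vars_def indep_sets_def)
next
  case False
  \<comment> \<open>Used with \<open>J = I\<close> for the joint probability and with singletons for
    the marginals. An empty \<open>J\<close> is excluded, as its intersection would be
    \<open>UNIV\<close>.\<close>
  have ind: "(\<integral>\<^sup>+\<omega>. (\<Prod>i\<in>J. indicator (B i) (X i \<omega>)) \<partial>M) = ennreal (prob (\<Inter>j\<in>J. X j -` B j \<inter> space M))"
    if B: "B \<in> (\<Pi> i\<in>I. sets (N i))" and J: "J \<subseteq> I" "J \<noteq> {}" for B J
  proof -
    have fin: "finite J" using J I finite_subset by auto
    have "(\<integral>\<^sup>+\<omega>. (\<Prod>i\<in>J. indicator (B i) (X i \<omega>)) \<partial>M) =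
        (\<integral>\<^sup>+\<omega>. indicator (\<Inter>j\<in>J. X j -` B j \<inter> space M) \<omega> \<partial>M)"
    proof (rule nn_integral_cong)
      fix \<omega> assume "\<omega> \<in> space M"
      then show "(\<Prod>i\<in>J. indicator (B i) (X i \<omega>)) =
          (indicator (\<Inter>j\<in>J. X j -` B j \<inter> space M) \<omega> :: ennreal)"
        using fin J by (auto simp: indicator_def intro!: prod_zero)
    qed
    also have "\<dots> = emeasure M (\<Inter>j\<in>J. X j -` B j \<inter> space M)"
      using fin J B X by (intro nn_integral_indicator sets.finite_INT measurable_sets) auto
    finally show ?thesis by (simp add: emeasure_eq_measure)
  qed
  show ?thesis
  proof (subst indep_vars_finite[where E="\<lambda>i. sets (N i)"])
    show "\<forall>A\<in>(\<Pi> i\<in>I. sets (N i)). prob (\<Inter>j\<in>I. X j -` A j \<inter> space M) =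
        (\<Prod>j\<in>I. prob (X j -` A j \<inter> space M))"
    proof
      fix A assume A: "A \<in> (\<Pi> i\<in>I. sets (N i))"
      have "ennreal (prob (\<Inter>j\<in>I. X j -` A j \<inter> space M)) =
          (\<Prod>i\<in>I. \<integral>\<^sup>+\<omega>. indicator (A i) (X i \<omega>) \<partial>M)"
        unfolding ind[OF A subset_refl False, symmetric] using A by (intro eq) auto
      also have "\<dots> = (\<Prod>i\<in>I. ennreal (prob (X i -` A i \<inter> space M)))"
        using ind[OF A, of "{i}" for i] by (intro prod.cong) auto
      also have "\<dots> = ennreal (\<Prod>i\<in>I. prob (X i -` A i \<inter> space M))"
        by (simp add: prod_ennreal)
      finally show "prob (\<Inter>j\<in>I. X j -` A j \<inter> space M) = (\<Prod>j\<in>I. prob (X j -` A j \<inter> space M))"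
        by (simp add: prod_nonneg)
    qed
  qed (use False I X sets.space_closed in \<open>auto simp: sets.sigma_sets_eq sets.Int_stable\<close>)
qed

lemma nn_integral_prod_indicator_indep:
  assumes "finite I" "indep_vars N X I" "\<And>i. i \<in> I \<Longrightarrow> B i \<in> sets (N i)"
  shows "(\<integral>\<^sup>+\<omega>. (\<Prod>i\<in>I. indicator (B i) (X i \<omega>)) \<partial>M) = (\<Prod>i\<in>I. \<integral>\<^sup>+\<omega>. indicator (B i) (X i \<omega>) \<partial>M)"
  by (rule indep_vars_nn_integral[OF assms(1) indep_vars_compose2[OF assms(2)]])
     (use assms(3) in auto)

text \<open>The expectation factors in two stages: across the independent rows \<open>X i\<close>,
  then across the entries of each row. In the application rows are processes and columns are time
  steps.\<close>

lemma indep_vars_Times: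
  assumes I: "finite I" "finite K"
    and out: "indep_vars (\<lambda>_. PiM K N) (\<lambda>i \<omega>. \<lambda>k\<in>K. X i k \<omega>) I"
    and inn: "\<And>i. i \<in> I \<Longrightarrow> indep_vars N (X i) K"
  shows "indep_vars (\<lambda>p. N (snd p)) (\<lambda>p. X (fst p) (snd p)) (I \<times> K)"
proof (rule indep_varsI_nn_integral)
  show "finite (I \<times> K)" using I by simp
  show "X (fst p) (snd p) \<in> measurable M (N (snd p))" if "p \<in> I \<times> K" for p
    using inn[of "fst p"] that by (auto simp: indep_vars_def)
  fix B assume B: "\<And>p. p \<in> I \<times> K \<Longrightarrow> B p \<in> sets (N (snd p))"
  have "(\<integral>\<^sup>+\<omega>. (\<Prod>p\<in>I\<times>K. indicator (B p) (X (fst p) (snd p) \<omega>)) \<partial>M) =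
      (\<integral>\<^sup>+\<omega>. (\<Prod>i\<in>I. \<Prod>k\<in>K. indicator (B (i, k)) ((\<lambda>k\<in>K. X i k \<omega>) k)) \<partial>M)"
    by (simp add: prod.cartesian_product split_beta)
  also have "\<dots> = (\<Prod>i\<in>I. \<integral>\<^sup>+\<omega>. (\<Prod>k\<in>K. indicator (B (i, k)) ((\<lambda>k\<in>K. X i k \<omega>) k)) \<partial>M)"
  proof (rule indep_vars_nn_integral[OF I(1)])
    show "indep_vars (\<lambda>_. borel)
        (\<lambda>i \<omega>. \<Prod>k\<in>K. indicator (B (i, k)) ((\<lambda>k\<in>K. X i k \<omega>) k) :: ennreal) I"
    proof (rule indep_vars_compose2[OF out])
      fix i assume i: "i \<in> I"
      have "(\<lambda>x. indicator (B (i, k)) (x k) :: ennreal) \<in> borel_measurable (PiM K N)" if "k \<in> K" for k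
        using B[of "(i, k)"] i that
        by (intro measurable_compose[OF measurable_component_singleton borel_measurable_indicator]) auto
      then show "(\<lambda>x. \<Prod>k\<in>K. indicator (B (i, k)) (x k) :: ennreal) \<in> borel_measurable (PiM K N)"
        by (intro borel_measurable_prod_ennreal)
    qed
  qed simp
  also have "\<dots> = (\<Prod>i\<in>I. \<Prod>k\<in>K. \<integral>\<^sup>+\<omega>. indicator (B (i, k)) (X i k \<omega>) \<partial>M)"
  proof (rule prod.cong[OF refl])
    fix i assume i: "i \<in> I"
    show "(\<integral>\<^sup>+\<omega>. (\<Prod>k\<in>K. indicator (B (i, k)) ((\<lambda>k\<in>K. X i k \<omega>) k)) \<partial>M) =
        (\<Prod>k\<in>K. \<integral>\<^sup>+\<omega>. indicator (B (i, k)) (X i k \<omega>) \<partial>M)"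
      using nn_integral_prod_indicator_indep[OF I(2) inn[OF i], of "\<lambda>k. B (i, k)"] B[of "(i, _)"] i
      by simp
  qed
  finally show "(\<integral>\<^sup>+\<omega>. (\<Prod>p\<in>I\<times>K. indicator (B p) (X (fst p) (snd p) \<omega>)) \<partial>M) =
      (\<Prod>p\<in>I\<times>K. \<integral>\<^sup>+\<omega>. indicator (B p) (X (fst p) (snd p) \<omega>) \<partial>M)"
    by (simp add: prod.cartesian_product split_beta)
qed

section \<open>Linear combinations of independent processes\<close>

lemma independent_increments_sum:
  fixes X :: "'i \<Rightarrow> real \<Rightarrow> 'a \<Rightarrow> real"
  assumes I: "finite I"
    and ind: "indep_vars (\<lambda>_. path_space) (\<lambda>i. path_of (X i)) I"
    and inc: "\<And>i. i \<in> I \<Longrightarrow> independent_increments M (X i)"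
  shows "independent_increments M (\<lambda>t \<omega>. \<Sum>i\<in>I. c i * X i t \<omega>)"
  unfolding independent_increments_def
proof (intro allI impI)
  fix k :: nat and t :: "nat \<Rightarrow> real" assume t: "0 \<le> t 0 \<and> incseq t"
  have t0: "0 \<le> t j" for j using t incseqD[of t 0 j] by auto
  let ?D = "\<lambda>i j \<omega>. X i (t (Suc j)) \<omega> - X i (t j) \<omega>"
  have "indep_vars (\<lambda>_. PiM {..<k} (\<lambda>_. borel))
      (\<lambda>i \<omega>. \<lambda>j\<in>{..<k}. path_of (X i) \<omega> (t (Suc j)) - path_of (X i) \<omega> (t j)) I"
    by (rule indep_vars_compose2[OF ind])
      (use t0 in \<open>intro measurable_restrict borel_measurable_diff measurable_component_singleton; simp\<close>)
  then have "indep_vars (\<lambda>p. borel) (\<lambda>p. ?D (fst p) (snd p)) (I \<times> {..<k})"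
    by (intro indep_vars_Times I) (use t t0 inc in \<open>auto simp: path_of_def independent_increments_def\<close>)
  \<comment> \<open>The independent array of increments is regrouped by time step: the columns
    \<open>I \<times> {j}\<close> are disjoint, hence independent, and each increment of the sum is
    a function of one column.\<close>
  then have "indep_vars (\<lambda>j. PiM (I \<times> {j}) (\<lambda>_. borel))
      (\<lambda>j \<omega>. \<lambda>p\<in>I \<times> {j}. ?D (fst p) (snd p) \<omega>) {..<k}"
    by (rule indep_vars_restrict) (auto simp: disjoint_family_on_def)
  then have "indep_vars (\<lambda>j. borel)
      (\<lambda>j \<omega>. \<Sum>i\<in>I. c i * (\<lambda>p\<in>I \<times> {j}. ?D (fst p) (snd p) \<omega>) (i, j)) {..<k}"
    by (rule indep_vars_compose2) measurable
  then show "indep_vars (\<lambda>_. borel) (\<lambda>j \<omega>. (\<Sum>i\<in>I. c i * X i (t (Suc j)) \<omega>) -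
      (\<Sum>i\<in>I. c i * X i (t j) \<omega>)) {..<k}"
    by (simp add: sum_subtractf[symmetric] right_diff_distrib)
qed

text \<open>By independence the weighted sum is distributed as the image of the product of the
  marginal laws, so only these laws matter. The empty index set is separate because the product
  characterization of independence is applied with \<open>I\<close> nonempty.\<close>

lemma distr_sum_indep_cong:
  fixes X Y :: "'i \<Rightarrow> 'a \<Rightarrow> real"
  assumes X: "indep_vars (\<lambda>_. borel) X I" and Y: "indep_vars (\<lambda>_. borel) Y I"
    and eq: "\<And>i. i \<in> I \<Longrightarrow> distr M borel (X i) = distr M borel (Y i)"
  shows "distr M borel (\<lambda>\<omega>. \<Sum>i\<in>I. c i * X i \<omega>) = distr M borel (\<lambda>\<omega>. \<Sum>i\<in>I. c i * Y i \<omega>)"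
proof (cases "I = {}")
  case False
  have *: "distr M borel (\<lambda>\<omega>. \<Sum>i\<in>I. c i * Z i \<omega>) =
      distr (\<Pi>\<^sub>M i\<in>I. distr M borel (Z i)) borel (\<lambda>x. \<Sum>i\<in>I. c i * x i)"
    if Z: "indep_vars (\<lambda>_. borel) Z I" for Z
  proof -
    have rv: "\<And>i. i \<in> I \<Longrightarrow> random_variable borel (Z i)" using Z by (simp add: indep_vars_def)
    have "(\<Pi>\<^sub>M i\<in>I. distr M borel (Z i)) = distr M (PiM I (\<lambda>_. borel)) (\<lambda>\<omega>. \<lambda>i\<in>I. Z i \<omega>)"
      using indep_vars_iff_distr_eq_PiM'[OF False rv] Z by simp
    then show ?thesis
      using rv by (simp add: distr_distr comp_def)
  qed
  have "(\<Pi>\<^sub>M i\<in>I. distr M borel (X i)) = (\<Pi>\<^sub>M i\<in>I. distr M borel (Y i))"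
    by (rule PiM_cong) (auto simp: eq)
  then show ?thesis using *[OF X] *[OF Y] by simp
qed simp

lemma stationary_increments_sum:
  fixes X :: "'i \<Rightarrow> real \<Rightarrow> 'a \<Rightarrow> real"
  assumes ind: "indep_vars (\<lambda>_. path_space) (\<lambda>i. path_of (X i)) I"
    and st: "\<And>i. i \<in> I \<Longrightarrow> stationary_increments M (X i)"
  shows "stationary_increments M (\<lambda>t \<omega>. \<Sum>i\<in>I. c i * X i t \<omega>)"
  unfolding stationary_increments_def
proof (intro allI impI)
  fix s t :: real assume t: "0 \<le> s" "0 \<le> t"
  have "indep_vars (\<lambda>_. borel) (\<lambda>i \<omega>. path_of (X i) \<omega> (s + t) - path_of (X i) \<omega> s) I"
    by (rule indep_vars_compose2[OF ind])
      (use t in \<open>auto intro!: borel_measurable_diff measurable_component_singleton\<close>)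
  then have 1: "indep_vars (\<lambda>_. borel) (\<lambda>i \<omega>. X i (s + t) \<omega> - X i s \<omega>) I"
    using t by (simp add: path_of_def)
  have "indep_vars (\<lambda>_. borel) (\<lambda>i \<omega>. path_of (X i) \<omega> t) I"
    by (rule indep_vars_compose2[OF ind])
      (use t in \<open>auto intro!: borel_measurable_diff measurable_component_singleton\<close>)
  then have 2: "indep_vars (\<lambda>_. borel) (\<lambda>i \<omega>. X i t \<omega>) I"
    using t by (simp add: path_of_def)
  have "distr M borel (\<lambda>\<omega>. \<Sum>i\<in>I. c i * (X i (s + t) \<omega> - X i s \<omega>)) =
      distr M borel (\<lambda>\<omega>. \<Sum>i\<in>I. c i * X i t \<omega>)"
    using st t by (intro distr_sum_indep_cong 1 2) (auto simp: stationary_increments_def)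
  then show "distr M borel (\<lambda>\<omega>. (\<Sum>i\<in>I. c i * X i (s + t) \<omega>) - (\<Sum>i\<in>I. c i * X i s \<omega>)) =
      distr M borel (\<lambda>\<omega>. \<Sum>i\<in>I. c i * X i t \<omega>)"
    by (simp add: sum_subtractf[symmetric] right_diff_distrib)
qed

end

section \<open>The exponent of the tempered stable subordinator\<close>

text \<open>This is the Levy-Khintchine formula of the tempered stable subordinator. It is applied
  later with \<open>\<psi> \<mu>\<close> in place of \<open>\<mu>\<close>, to evaluate the exponent
  of the mixture.\<close>

lemma tempered_stable_exponent:
  fixes a \<beta> \<mu> :: real
  assumes a: "0 < a" and \<beta>: "0 < \<beta>" "\<beta> < 1" and \<mu>: "0 \<le> \<mu>"
  shows "(\<integral>\<^sup>+t\<in>{0<..}. ennreal (exp (- a * t) * (1 - exp (- \<mu> * t)) *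
      (\<beta> * t powr (- (1 + \<beta>)) / Gamma (1 - \<beta>))) \<partial>lborel) = ennreal ((a + \<mu>) powr \<beta> - a powr \<beta>)"
proof -
  define G where "G = Gamma (1 - \<beta>)"
  have G: "0 < G" unfolding G_def using \<beta> by (intro Gamma_real_pos) auto
  let ?h = "\<lambda>t u. ennreal (\<beta> / G * (t powr (- \<beta>) * exp (- u * t)) * indicator {0<..} t * indicator {a..a+\<mu>} u)"
  \<comment> \<open>\<open>e\<^bsup>-at\<^esup> - e\<^bsup>-(a+\<mu>)t\<^esup>\<close> is the integral of \<open>t e\<^bsup>-ut\<^esup>\<close> over \<open>u \<in> [a, a+\<mu>]\<close>; swapping the integrals leaves
    a Gamma integral in \<open>t\<close>.\<close>
  have inner: "ennreal (exp (- a * t) * (1 - exp (- \<mu> * t)) * (\<beta> * t powr (- (1 + \<beta>)) / G)) *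
      indicator {0<..} t = (\<integral>\<^sup>+u. ?h t u \<partial>lborel)" for t
  proof (cases "0 < t")
    case True
    have "(\<integral>\<^sup>+u. ennreal (t * exp (- u * t)) * indicator {a..a+\<mu>} u \<partial>lborel) =
        ennreal ((- exp (- (a + \<mu>) * t)) - (- exp (- a * t)))"
      using True \<mu> by (intro nn_integral_FTC_Icc) (auto intro!: derivative_eq_intros)
    also have "(- exp (- (a + \<mu>) * t)) - (- exp (- a * t)) = exp (- a * t) * (1 - exp (- \<mu> * t))"
      by (simp add: algebra_simps exp_add[symmetric])
    finally have "ennreal (\<beta> / G * t powr (- (1 + \<beta>))) * ennreal (exp (- a * t) * (1 - exp (- \<mu> * t))) =
        ennreal (\<beta> / G * t powr (- (1 + \<beta>))) *
          (\<integral>\<^sup>+u. ennreal (t * exp (- u * t)) * indicator {a..a+\<mu>} u \<partial>lborel)"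
      by simp
    also have "\<dots> = (\<integral>\<^sup>+u. ennreal (\<beta> / G * t powr (- (1 + \<beta>))) *
        (ennreal (t * exp (- u * t)) * indicator {a..a+\<mu>} u) \<partial>lborel)"
      by (rule nn_integral_cmult[symmetric]) measurable
    also have "\<dots> = (\<integral>\<^sup>+u. ?h t u \<partial>lborel)"
    proof (rule nn_integral_cong)
      fix u :: real
      have "t powr (- (1 + \<beta>)) * t = t powr (- \<beta>)"
        using True powr_mult_base[of t "- (1 + \<beta>)"] by (simp add: mult.commute)
      then have "\<beta> / G * t powr (- (1 + \<beta>)) * (t * exp (- u * t)) = \<beta> / G * (t powr (- \<beta>) * exp (- u * t))"
        by (metis mult.assoc)
      then show "ennreal (\<beta> / G * t powr (- (1 + \<beta>))) *
          (ennreal (t * exp (- u * t)) * indicator {a..a+\<mu>} u) = ?h t u"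
        using True \<beta> G
        by (auto simp: indicator_def ennreal_mult'[symmetric])
    qed
    finally show ?thesis
      using True \<beta> G \<mu> by (simp add: ennreal_mult'[symmetric] ac_simps)
  qed simp
  have outer: "(\<integral>\<^sup>+t. ?h t u \<partial>lborel) = ennreal (\<beta> * u powr (\<beta> - 1)) * indicator {a..a+\<mu>} u" for u
  proof (cases "u \<in> {a..a+\<mu>}")
    case True
    then have u: "0 < u" using a by auto
    have "(\<integral>\<^sup>+t. ?h t u \<partial>lborel) = (\<integral>\<^sup>+t. ennreal (\<beta> / G) * ennreal ((t powr (- \<beta>) * exp (- u * t)) * indicator {0<..} t) \<partial>lborel)"
      using True \<beta> G by (intro nn_integral_cong) (auto simp: ennreal_mult'[symmetric] indicator_def)
    also have "\<dots> = ennreal (\<beta> / G) * (\<integral>\<^sup>+t. ennreal ((t powr (- \<beta>) * exp (- u * t)) * indicator {0<..} t) \<partial>lborel)"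
      by (rule nn_integral_cmult) measurable
    \<comment> \<open>The substitution \<open>t = x / u\<close> collects the dependence on
      \<open>u\<close> in the factor \<open>u powr (\<beta> - 1)\<close> and leaves the integral for
      \<open>Gamma (1 - \<beta>)\<close>.\<close>
    also have "(\<integral>\<^sup>+t. ennreal ((t powr (- \<beta>) * exp (- u * t)) * indicator {0<..} t) \<partial>lborel) =
        ennreal \<bar>1/u\<bar> * (\<integral>\<^sup>+x. ennreal (((0 + 1/u * x) powr (- \<beta>) * exp (- u * (0 + 1/u * x))) *
          indicator {0<..} (0 + 1/u * x)) \<partial>lborel)"
      using u by (intro nn_integral_real_affine) auto
    also have "\<dots> = (\<integral>\<^sup>+x. ennreal \<bar>1/u\<bar> * ennreal (((0 + 1/u * x) powr (- \<beta>) * exp (- u * (0 + 1/u * x))) *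
          indicator {0<..} (0 + 1/u * x)) \<partial>lborel)"
      by (rule nn_integral_cmult[symmetric]) measurable
    also have "\<dots> = (\<integral>\<^sup>+x. ennreal (u powr (\<beta> - 1)) * ennreal (indicator {0..} x * x powr ((1 - \<beta>) - 1) / exp x) \<partial>lborel)"
    proof (rule nn_integral_cong)
      fix x :: real
      show "ennreal \<bar>1/u\<bar> * ennreal (((0 + 1/u * x) powr (- \<beta>) * exp (- u * (0 + 1/u * x))) *
          indicator {0<..} (0 + 1/u * x)) =
          ennreal (u powr (\<beta> - 1)) * ennreal (indicator {0..} x * x powr ((1 - \<beta>) - 1) / exp x)"
      proof (cases "0 < x")
        case True
        have "1 / u * ((1/u * x) powr (- \<beta>)) = u powr (\<beta> - 1) * x powr (- \<beta>)"
          using u True by (simp add: powr_mult powr_divide powr_minus powr_diff field_simps)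
        then show ?thesis
          using u True by (simp add: ennreal_mult'[symmetric] exp_minus field_simps)
      next
        case False
        \<comment> \<open>At \<open>x = 0\<close> the open and the closed half-line differ, but
          \<open>0 powr y = 0\<close> makes both sides vanish.\<close>
        then show ?thesis using u by (cases "x = 0") (auto simp: indicator_def zero_less_divide_iff)
      qed
    qed
    also have "\<dots> = ennreal (u powr (\<beta> - 1)) * ennreal G"
      unfolding G_def using \<beta> by (subst nn_integral_cmult) (auto simp: Gamma_conv_nn_integral_real)
    finally show ?thesis
      using True \<beta> G by (simp add: ennreal_mult'[symmetric])
  qed simp
  have "(\<integral>\<^sup>+t\<in>{0<..}. ennreal (exp (- a * t) * (1 - exp (- \<mu> * t)) *
      (\<beta> * t powr (- (1 + \<beta>)) / G)) \<partial>lborel) = (\<integral>\<^sup>+t. \<integral>\<^sup>+u. ?h t u \<partial>lborel \<partial>lborel)"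
    unfolding inner ..
  also have "\<dots> = (\<integral>\<^sup>+u. \<integral>\<^sup>+t. ?h t u \<partial>lborel \<partial>lborel)"
    by (rule lborel_pair.Fubini'[symmetric]) measurable
  also have "\<dots> = (\<integral>\<^sup>+u. ennreal (\<beta> * u powr (\<beta> - 1)) * indicator {a..a+\<mu>} u \<partial>lborel)"
    by (simp only: outer)
  also have "\<dots> = ennreal ((a + \<mu>) powr \<beta> - a powr \<beta>)"
    using a \<beta> \<mu> by (intro nn_integral_FTC_Icc) (auto intro!: derivative_eq_intros)
  finally show ?thesis by (simp add: G_def)
qed

section \<open>Laplace exponents\<close>

context prob_space
begin

lemma has_laplace_exponentD_nn_integral:
  assumes "has_laplace_exponent M X \<Phi>" "0 \<le> t" "0 \<le> \<mu>"
  shows "(\<integral>\<^sup>+\<omega>. ennreal (exp (- \<mu> * X t \<omega>)) \<partial>M) = ennreal (exp (- t * \<Phi> \<mu>))"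
proof -
  have eq: "(\<integral>\<omega>. exp (- \<mu> * X t \<omega>) \<partial>M) = exp (- t * \<Phi> \<mu>)"
    using assms by (simp add: has_laplace_exponent_def)
  \<comment> \<open>A non-integrable function has Bochner integral 0 by convention, whereas the
    right-hand side of \<open>eq\<close> is positive.\<close>
  then have "integrable M (\<lambda>\<omega>. exp (- \<mu> * X t \<omega>))"
    by (rule_tac ccontr) (simp add: not_integrable_integral_eq)
  then show ?thesis using eq by (subst nn_integral_eq_integral) auto
qed

lemma has_laplace_exponentI_nn_integral:
  assumes "\<And>t. 0 \<le> t \<Longrightarrow> X t \<in> borel_measurable M"
    and "\<And>t \<mu>. 0 \<le> t \<Longrightarrow> 0 \<le> \<mu> \<Longrightarrow>
      (\<integral>\<^sup>+\<omega>. ennreal (exp (- \<mu> * X t \<omega>)) \<partial>M) = ennreal (exp (- t * \<Phi> \<mu>))"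
  shows "has_laplace_exponent M X \<Phi>"
  unfolding has_laplace_exponent_def using assms
  by (auto simp: integral_eq_nn_integral)

text \<open>The exponential of the sum is a product of independent factors. Nonnegative weights keep
  the arguments \<open>\<mu> * c i\<close> in the range where the exponents \<open>\<Phi> i\<close>
  are specified.\<close>

lemma has_laplace_exponent_sum:
  fixes X :: "'i \<Rightarrow> real \<Rightarrow> 'a \<Rightarrow> real"
  assumes I: "finite I" and c: "\<And>i. i \<in> I \<Longrightarrow> 0 \<le> c i"
    and ind: "indep_vars (\<lambda>_. path_space) (\<lambda>i. path_of (X i)) I"
    and \<Phi>: "\<And>i. i \<in> I \<Longrightarrow> has_laplace_exponent M (X i) (\<Phi> i)"
  shows "has_laplace_exponent M (\<lambda>t \<omega>. \<Sum>i\<in>I. c i * X i t \<omega>) (\<lambda>\<mu>. \<Sum>i\<in>I. \<Phi> i (\<mu> * c i))"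
proof -
  have X: "indep_vars (\<lambda>_. borel) (\<lambda>i \<omega>. X i t \<omega>) I" if t: "0 \<le> t" for t
  proof -
    have "indep_vars (\<lambda>_. borel) (\<lambda>i \<omega>. path_of (X i) \<omega> t) I"
      by (rule indep_vars_compose2[OF ind]) (use t in \<open>auto intro!: measurable_component_singleton\<close>)
    then show ?thesis using t by (simp add: path_of_def)
  qed
  show ?thesis
  proof (rule has_laplace_exponentI_nn_integral)
    show "(\<lambda>\<omega>. \<Sum>i\<in>I. c i * X i t \<omega>) \<in> borel_measurable M" if "0 \<le> t" for t
      using X[OF that] by (intro borel_measurable_sum borel_measurable_times) (auto simp: indep_vars_def)
    fix t \<mu> :: real assume t: "0 \<le> t" and \<mu>: "0 \<le> \<mu>"
    have "(\<integral>\<^sup>+\<omega>. ennreal (exp (- \<mu> * (\<Sum>i\<in>I. c i * X i t \<omega>))) \<partial>M) =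
        (\<integral>\<^sup>+\<omega>. (\<Prod>i\<in>I. ennreal (exp (- (\<mu> * c i) * X i t \<omega>))) \<partial>M)"
      by (simp add: prod_ennreal exp_sum[OF I, symmetric] sum_distrib_left sum_negf mult.assoc)
    also have "\<dots> = (\<Prod>i\<in>I. \<integral>\<^sup>+\<omega>. ennreal (exp (- (\<mu> * c i) * X i t \<omega>)) \<partial>M)"
      by (intro indep_vars_nn_integral[OF I] indep_vars_compose2[OF X[OF t]]) auto
    also have "\<dots> = (\<Prod>i\<in>I. ennreal (exp (- t * \<Phi> i (\<mu> * c i))))"
      using c \<mu> t by (intro prod.cong refl has_laplace_exponentD_nn_integral \<Phi>) auto
    also have "\<dots> = ennreal (exp (- t * (\<Sum>i\<in>I. \<Phi> i (\<mu> * c i))))"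
      by (simp add: prod_ennreal exp_sum[OF I, symmetric] sum_distrib_left sum_negf)
    finally show "(\<integral>\<^sup>+\<omega>. ennreal (exp (- \<mu> * (\<Sum>i\<in>I. c i * X i t \<omega>))) \<partial>M) =
        ennreal (exp (- t * (\<Sum>i\<in>I. \<Phi> i (\<mu> * c i))))" .
  qed
qed

end

section \<open>Time change by an independent process: setting and measurability\<close>

text \<open>\<open>NS\<close> and \<open>NT\<close> are sub-\<open>\<sigma>\<close>-algebras carrying \<open>S\<close> and \<open>T\<close>.  Working with them instead of
  \<open>path_space\<close> keeps right-continuous paths, without which evaluation of \<open>S\<close> at a random time is
  not measurable.\<close>

locale subordination = prob_space M for M :: "'a measure" +
  fixes NS NT :: "'a measure" and S T :: "real \<Rightarrow> 'a \<Rightarrow> real"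
  assumes space: "space NS = space M" "space NT = space M"
    and indep: "indep_set (sets NT) (sets NS)"
    and S_measurable: "\<And>t. 0 \<le> t \<Longrightarrow> S t \<in> borel_measurable NS"
    and S_0: "\<And>\<omega>. \<omega> \<in> space M \<Longrightarrow> S 0 \<omega> = 0"
    and S_mono: "\<And>\<omega>. \<omega> \<in> space M \<Longrightarrow> mono_on {0..} (\<lambda>t. S t \<omega>)"
    and S_rc: "\<And>\<omega> t. \<omega> \<in> space M \<Longrightarrow> 0 \<le> t \<Longrightarrow> continuous (at_right t) (\<lambda>u. S u \<omega>)"
    and S_ind: "independent_increments M S" and S_st: "stationary_increments M S"
    and T_measurable: "\<And>t. 0 \<le> t \<Longrightarrow> T t \<in> borel_measurable NT"
    and T_0: "\<And>\<omega>. \<omega> \<in> space M \<Longrightarrow> T 0 \<omega> = 0"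
    and T_mono: "\<And>\<omega>. \<omega> \<in> space M \<Longrightarrow> mono_on {0..} (\<lambda>t. T t \<omega>)"
    and T_rc: "\<And>\<omega> t. \<omega> \<in> space M \<Longrightarrow> 0 \<le> t \<Longrightarrow> continuous (at_right t) (\<lambda>u. T u \<omega>)"
    and T_ind: "independent_increments M T" and T_st: "stationary_increments M T"
begin

abbreviation W :: "real \<Rightarrow> 'a \<Rightarrow> real" where "W t \<omega> \<equiv> S (T t \<omega>) \<omega>"

lemma T_le: "\<omega> \<in> space M \<Longrightarrow> 0 \<le> s \<Longrightarrow> s \<le> t \<Longrightarrow> T s \<omega> \<le> T t \<omega>"
  using T_mono[of \<omega>] by (auto simp: mono_on_def)

lemma T_nonneg: "\<omega> \<in> space M \<Longrightarrow> 0 \<le> t \<Longrightarrow> 0 \<le> T t \<omega>"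
  using T_le[of \<omega> 0 t] T_0 by auto

lemma S_le: "\<omega> \<in> space M \<Longrightarrow> 0 \<le> s \<Longrightarrow> s \<le> t \<Longrightarrow> S s \<omega> \<le> S t \<omega>"
  using S_mono[of \<omega>] by (auto simp: mono_on_def)

lemma S_nonneg: "\<omega> \<in> space M \<Longrightarrow> 0 \<le> t \<Longrightarrow> 0 \<le> S t \<omega>"
  using S_le[of \<omega> 0 t] S_0 by auto

lemma subalgebras: "subalgebra M NS" "subalgebra M NT"
  using indep by (auto simp: subalgebra_def space dest: indep_setD_ev1 indep_setD_ev2)

lemma S_measurable_M: "0 \<le> t \<Longrightarrow> S t \<in> borel_measurable M"
  by (rule measurable_from_subalg[OF subalgebras(1) S_measurable])

lemma T_measurable_M: "0 \<le> t \<Longrightarrow> T t \<in> borel_measurable M"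
  by (rule measurable_from_subalg[OF subalgebras(2) T_measurable])

text \<open>The version over \<open>NS\<close> feeds the double integral, where \<open>S\<close> has
  its own coordinate; the version over \<open>M\<close> serves measurability of \<open>W t\<close>
  and of the laws of \<open>S t\<close> as functions of \<open>t\<close>.\<close>

lemma S_joint:
  "(\<lambda>p. S (max 0 (fst p)) (snd p)) \<in> borel_measurable (borel \<Otimes>\<^sub>M NS)"
  "(\<lambda>p. S (max 0 (fst p)) (snd p)) \<in> borel_measurable (borel \<Otimes>\<^sub>M M)"
  by (rule right_continuous_process_measurable; simp add: S_measurable S_measurable_M S_rc space)+

text \<open>The decoupled form of \<open>W t\<close>: \<open>T\<close> reads the first coordinate
  and \<open>S\<close> the second. On the diagonal it agrees with \<open>W t\<close>, because
  \<open>T t\<close> is nonnegative.\<close>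

lemma W_joint:
  assumes t: "0 \<le> t"
  shows "(\<lambda>p. S (max 0 (T t (fst p))) (snd p)) \<in> borel_measurable (NT \<Otimes>\<^sub>M NS)"
proof -
  have "(\<lambda>p. (T t (fst p), snd p)) \<in> NT \<Otimes>\<^sub>M NS \<rightarrow>\<^sub>M borel \<Otimes>\<^sub>M NS"
    using T_measurable[OF t] by measurable
  from measurable_compose[OF this S_joint(1)] show ?thesis by simp
qed

lemma W_measurable:
  assumes t: "0 \<le> t"
  shows "W t \<in> borel_measurable M"
proof -
  have "(\<lambda>\<omega>. (T t \<omega>, \<omega>)) \<in> M \<rightarrow>\<^sub>M borel \<Otimes>\<^sub>M M"
    using T_measurable_M[OF t] by measurable
  from measurable_compose[OF this S_joint(2)]
  have "(\<lambda>\<omega>. S (max 0 (T t \<omega>)) \<omega>) \<in> borel_measurable M" by simp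
  then show ?thesis
    by (rule measurable_cong[THEN iffD1, rotated]) (simp add: T_nonneg t max_absorb2)
qed

section \<open>Increments of the time-changed process\<close>

text \<open>The transition probability of \<open>S\<close> over a time span \<open>s\<close>;
  \<open>max 0\<close> makes it a Borel function on the whole line, so it can be composed with
  increments of \<open>T\<close>.\<close>

definition trans_prob :: "real set \<Rightarrow> real \<Rightarrow> ennreal" where
  "trans_prob B s = (\<integral>\<^sup>+\<omega>. indicator B (S (max 0 s) \<omega>) \<partial>M)"

lemma trans_prob_measurable:
  assumes B: "B \<in> sets borel"
  shows "trans_prob B \<in> borel_measurable borel"
proof -
  have "(\<lambda>p. indicator B (S (max 0 (fst p)) (snd p)) :: ennreal) \<in> borel_measurable (borel \<Otimes>\<^sub>M M)"
    using B by (intro measurable_compose[OF S_joint(2)] borel_measurable_indicator) auto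
  from borel_measurable_nn_integral_fst[OF this] show ?thesis
    unfolding trans_prob_def by simp
qed

lemma nn_integral_indicator_increment:
  assumes ab: "0 \<le> a" "a \<le> b" and B: "B \<in> sets borel"
  shows "(\<integral>\<^sup>+\<omega>. indicator B (S b \<omega> - S a \<omega>) \<partial>M) = trans_prob B (b - a)"
proof -
  have [measurable]: "S a \<in> borel_measurable M" "S b \<in> borel_measurable M" "S (b - a) \<in> borel_measurable M"
    using ab by (auto intro: S_measurable_M)
  have D: "distr M borel (\<lambda>\<omega>. S b \<omega> - S a \<omega>) = distr M borel (S (b - a))"
    using S_st[unfolded stationary_increments_def, rule_format, of a "b - a"] ab by simp
  have "(\<integral>\<^sup>+\<omega>. indicator B (S b \<omega> - S a \<omega>) \<partial>M) =
      (\<integral>\<^sup>+x. indicator B x \<partial>distr M borel (\<lambda>\<omega>. S b \<omega> - S a \<omega>))"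
    using B by (subst nn_integral_distr) auto
  also have "\<dots> = trans_prob B (b - a)"
    unfolding D trans_prob_def using B ab by (subst nn_integral_distr) auto
  finally show ?thesis .
qed

text \<open>For a frozen path of \<open>T\<close> the times \<open>T (t i)\<close> are deterministic
  and nondecreasing, so the independent increments of \<open>S\<close> factor the inner integral;
  stationarity leaves in each factor only the increment of \<open>T\<close>.\<close>

lemma nn_integral_indicator_subordinated_increments:
  assumes t: "0 \<le> t 0" "incseq t" and B: "\<And>i. i < k \<Longrightarrow> B i \<in> sets borel"
  shows "(\<integral>\<^sup>+\<omega>. (\<Prod>i<k. indicator (B i) (W (t (Suc i)) \<omega> - W (t i) \<omega>)) \<partial>M) =
    (\<integral>\<^sup>+\<omega>. (\<Prod>i<k. trans_prob (B i) (T (t (Suc i)) \<omega> - T (t i) \<omega>)) \<partial>M)"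
proof -
  have t0: "0 \<le> t i" for i using t incseqD[of t 0 i] by auto
  let ?f = "\<lambda>p. \<Prod>i<k. indicator (B i) (S (max 0 (T (t (Suc i)) (fst p))) (snd p) -
      S (max 0 (T (t i) (fst p))) (snd p)) :: ennreal"
  have f: "?f \<in> borel_measurable (NT \<Otimes>\<^sub>M NS)"
    using B t0
    by (intro borel_measurable_prod_ennreal measurable_compose[OF borel_measurable_diff
      borel_measurable_indicator] W_joint) auto
  have "(\<integral>\<^sup>+\<omega>. (\<Prod>i<k. indicator (B i) (W (t (Suc i)) \<omega> - W (t i) \<omega>)) \<partial>M) = (\<integral>\<^sup>+\<omega>. ?f (\<omega>, \<omega>) \<partial>M)"
    by (intro nn_integral_cong) (simp add: max_absorb2 T_nonneg t0)
  also have "\<dots> = (\<integral>\<^sup>+\<omega>. \<integral>\<^sup>+\<omega>'. ?f (\<omega>, \<omega>') \<partial>M \<partial>M)"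
    by (intro nn_integral_indep_diagonal[OF space(2) space(1) indep f])
  also have "\<dots> = (\<integral>\<^sup>+\<omega>. (\<Prod>i<k. trans_prob (B i) (T (t (Suc i)) \<omega> - T (t i) \<omega>)) \<partial>M)"
  proof (rule nn_integral_cong)
    fix \<omega> assume \<omega>: "\<omega> \<in> space M"
    let ?u = "\<lambda>i. T (t i) \<omega>"
    have u: "0 \<le> ?u i" "?u i \<le> ?u (Suc i)" for i
      using \<omega> t0 T_nonneg T_le incseq_SucD[OF t(2)] by auto
    have "(\<integral>\<^sup>+\<omega>'. ?f (\<omega>, \<omega>') \<partial>M) =
        (\<integral>\<^sup>+\<omega>'. (\<Prod>i<k. indicator (B i) (S (?u (Suc i)) \<omega>' - S (?u i) \<omega>')) \<partial>M)"
      by (simp add: max_absorb2 u)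
    also have "\<dots> = (\<Prod>i<k. \<integral>\<^sup>+\<omega>'. indicator (B i) (S (?u (Suc i)) \<omega>' - S (?u i) \<omega>') \<partial>M)"
    proof (rule nn_integral_prod_indicator_indep[where N="\<lambda>_. borel"])
      have "incseq ?u" using u by (intro incseq_SucI)
      then show "indep_vars (\<lambda>_. borel) (\<lambda>i \<omega>'. S (?u (Suc i)) \<omega>' - S (?u i) \<omega>') {..<k}"
        using S_ind[unfolded independent_increments_def, rule_format, of ?u k] u(1)[of 0] by simp
    qed (use B in auto)
    also have "\<dots> = (\<Prod>i<k. trans_prob (B i) (?u (Suc i) - ?u i))"
      using u B by (intro prod.cong refl nn_integral_indicator_increment) auto
    finally show "(\<integral>\<^sup>+\<omega>'. ?f (\<omega>, \<omega>') \<partial>M) = (\<Prod>i<k. trans_prob (B i) (?u (Suc i) - ?u i))" .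
  qed
  finally show ?thesis .
qed

lemma nn_integral_indicator_subordinated_increment:
  assumes ab: "0 \<le> a" "a \<le> b" and B: "B \<in> sets borel"
  shows "(\<integral>\<^sup>+\<omega>. indicator B (W b \<omega> - W a \<omega>) \<partial>M) = (\<integral>\<^sup>+\<omega>. trans_prob B (T b \<omega> - T a \<omega>) \<partial>M)"
proof -
  \<comment> \<open>The case \<open>k = 1\<close>; the sequence is constant from index 1 on, which
    makes it increasing as a whole.\<close>
  define t where "t i = (if i = 0 then a else b)" for i :: nat
  have "0 \<le> t 0" "incseq t" using ab by (auto simp: t_def incseq_def)
  from nn_integral_indicator_subordinated_increments[OF this, of 1 "\<lambda>_. B"] B
  show ?thesis by (simp add: t_def)
qed

text \<open>The joint probability is the mean of a product of functions of single increments of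
  \<open>T\<close>. Independence of these increments splits the mean, and the one-increment formula
  turns each factor back into a probability for \<open>W\<close>.\<close>

lemma independent_increments_subordinated: "independent_increments M W"
  unfolding independent_increments_def
proof (intro allI impI)
  fix k :: nat and t :: "nat \<Rightarrow> real" assume t: "0 \<le> t 0 \<and> incseq t"
  have t0: "0 \<le> t i" "t i \<le> t (Suc i)" for i using t incseqD[of t 0 i] incseq_SucD[of t] by auto
  show "indep_vars (\<lambda>_. borel) (\<lambda>i \<omega>. W (t (Suc i)) \<omega> - W (t i) \<omega>) {..<k}"
  proof (rule indep_varsI_nn_integral)
    show "random_variable borel (\<lambda>\<omega>. W (t (Suc i)) \<omega> - W (t i) \<omega>)" for i
      using t0 by (intro borel_measurable_diff W_measurable) auto
    fix B :: "nat \<Rightarrow> real set" assume B: "\<And>i. i \<in> {..<k} \<Longrightarrow> B i \<in> sets borel"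
    have "(\<integral>\<^sup>+\<omega>. (\<Prod>i<k. indicator (B i) (W (t (Suc i)) \<omega> - W (t i) \<omega>)) \<partial>M) =
        (\<integral>\<^sup>+\<omega>. (\<Prod>i<k. trans_prob (B i) (T (t (Suc i)) \<omega> - T (t i) \<omega>)) \<partial>M)"
      using t B by (intro nn_integral_indicator_subordinated_increments) auto
    also have "\<dots> = (\<Prod>i<k. \<integral>\<^sup>+\<omega>. trans_prob (B i) (T (t (Suc i)) \<omega> - T (t i) \<omega>) \<partial>M)"
    proof (rule indep_vars_nn_integral)
      have "indep_vars (\<lambda>_. borel) (\<lambda>i \<omega>. T (t (Suc i)) \<omega> - T (t i) \<omega>) {..<k}"
        using T_ind t unfolding independent_increments_def by blast
      then show "indep_vars (\<lambda>_. borel) (\<lambda>i \<omega>. trans_prob (B i) (T (t (Suc i)) \<omega> - T (t i) \<omega>)) {..<k}"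
        using B by (rule_tac indep_vars_compose2) (auto intro: trans_prob_measurable)
    qed auto
    also have "\<dots> = (\<Prod>i<k. \<integral>\<^sup>+\<omega>. indicator (B i) (W (t (Suc i)) \<omega> - W (t i) \<omega>) \<partial>M)"
      using B t0
      by (intro prod.cong refl nn_integral_indicator_subordinated_increment[symmetric]) auto
    finally show "(\<integral>\<^sup>+\<omega>. (\<Prod>i<k. indicator (B i) (W (t (Suc i)) \<omega> - W (t i) \<omega>)) \<partial>M) =
        (\<Prod>i<k. \<integral>\<^sup>+\<omega>. indicator (B i) (W (t (Suc i)) \<omega> - W (t i) \<omega>) \<partial>M)" .
  qed simp
qed

lemma stationary_increments_subordinated: "stationary_increments M W"
  unfolding stationary_increments_def
proof (intro allI impI measure_eqI)
  fix s t :: real and B assume t: "0 \<le> s" "0 \<le> t"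
    and B': "B \<in> sets (distr M borel (\<lambda>\<omega>. W (s + t) \<omega> - W s \<omega>))"
  have B: "B \<in> sets borel" using B' by simp
  have em: "emeasure (distr M borel Z) B = (\<integral>\<^sup>+\<omega>. indicator B (Z \<omega>) \<partial>M)"
    if Z: "Z \<in> borel_measurable M" for Z
  proof -
    have "emeasure (distr M borel Z) B = (\<integral>\<^sup>+x. indicator B x \<partial>distr M borel Z)" using B by simp
    also have "\<dots> = (\<integral>\<^sup>+\<omega>. indicator B (Z \<omega>) \<partial>M)" using B Z by (intro nn_integral_distr) auto
    finally show ?thesis .
  qed
  have [measurable]: "T s \<in> borel_measurable M" "T t \<in> borel_measurable M" "T (s + t) \<in> borel_measurable M"
    "trans_prob B \<in> borel_measurable borel"
    using t B by (auto intro: T_measurable_M trans_prob_measurable)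
  have D: "distr M borel (\<lambda>\<omega>. T (s + t) \<omega> - T s \<omega>) = distr M borel (T t)"
    using T_st t by (auto simp: stationary_increments_def)
  have "emeasure (distr M borel (\<lambda>\<omega>. W (s + t) \<omega> - W s \<omega>)) B =
      (\<integral>\<^sup>+\<omega>. trans_prob B (T (s + t) \<omega> - T s \<omega>) \<partial>M)"
    using t B
    by (subst em) (auto intro: W_measurable
      intro!: nn_integral_indicator_subordinated_increment borel_measurable_diff)
  also have "\<dots> = (\<integral>\<^sup>+x. trans_prob B x \<partial>distr M borel (\<lambda>\<omega>. T (s + t) \<omega> - T s \<omega>))"
    by (subst nn_integral_distr) auto
  also have "\<dots> = (\<integral>\<^sup>+\<omega>. trans_prob B (T t \<omega>) \<partial>M)"
    unfolding D by (subst nn_integral_distr) auto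
  \<comment> \<open>Inserting \<open>T 0 = 0\<close> gives the shape of an increment, so the
    one-increment formula can be read backwards.\<close>
  also have "\<dots> = (\<integral>\<^sup>+\<omega>. trans_prob B (T t \<omega> - T 0 \<omega>) \<partial>M)"
    by (intro nn_integral_cong) (simp add: T_0)
  also have "\<dots> = (\<integral>\<^sup>+\<omega>. indicator B (W t \<omega> - W 0 \<omega>) \<partial>M)"
    using t B by (intro nn_integral_indicator_subordinated_increment[symmetric]) auto
  also have "\<dots> = (\<integral>\<^sup>+\<omega>. indicator B (W t \<omega>) \<partial>M)"
    by (intro nn_integral_cong) (simp add: T_0 S_0)
  also have "\<dots> = emeasure (distr M borel (W t)) B"
    using t by (simp add: em W_measurable)
  finally show "emeasure (distr M borel (\<lambda>\<omega>. W (s + t) \<omega> - W s \<omega>)) B =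
      emeasure (distr M borel (W t)) B" .
qed simp

section \<open>Laplace exponent and paths of the time-changed process\<close>

text \<open>For a frozen value of \<open>T t\<close> the inner integral is the Laplace transform of
  \<open>S\<close>, which leaves the transform of \<open>T t\<close> at \<open>\<psi> \<mu>\<close>;
  nonnegativity of \<open>\<psi> \<mu>\<close> makes this an admissible argument of
  \<open>\<Phi>\<close>.\<close>

lemma has_laplace_exponent_subordinated:
  assumes \<psi>: "has_laplace_exponent M S \<psi>" "\<And>\<mu>. 0 \<le> \<mu> \<Longrightarrow> 0 \<le> \<psi> \<mu>" and \<Phi>: "has_laplace_exponent M T \<Phi>"
  shows "has_laplace_exponent M W (\<lambda>\<mu>. \<Phi> (\<psi> \<mu>))"
proof (rule has_laplace_exponentI_nn_integral)
  fix t \<mu> :: real assume t: "0 \<le> t" and \<mu>: "0 \<le> \<mu>"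
  let ?f = "\<lambda>p. ennreal (exp (- \<mu> * S (max 0 (T t (fst p))) (snd p)))"
  have f: "?f \<in> borel_measurable (NT \<Otimes>\<^sub>M NS)"
    using W_joint[OF t] by measurable
  have "(\<integral>\<^sup>+\<omega>. ennreal (exp (- \<mu> * W t \<omega>)) \<partial>M) = (\<integral>\<^sup>+\<omega>. ?f (\<omega>, \<omega>) \<partial>M)"
    by (intro nn_integral_cong) (simp add: max_absorb2 T_nonneg t)
  also have "\<dots> = (\<integral>\<^sup>+\<omega>. \<integral>\<^sup>+\<omega>'. ?f (\<omega>, \<omega>') \<partial>M \<partial>M)"
    by (intro nn_integral_indep_diagonal[OF space(2) space(1) indep f])
  also have "\<dots> = (\<integral>\<^sup>+\<omega>. ennreal (exp (- \<psi> \<mu> * T t \<omega>)) \<partial>M)"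
  proof (rule nn_integral_cong)
    fix \<omega> assume \<omega>: "\<omega> \<in> space M"
    show "(\<integral>\<^sup>+\<omega>'. ?f (\<omega>, \<omega>') \<partial>M) = ennreal (exp (- \<psi> \<mu> * T t \<omega>))"
      using has_laplace_exponentD_nn_integral[OF \<psi>(1) T_nonneg[OF \<omega> t] \<mu>]
      unfolding fst_conv snd_conv max_absorb2[OF T_nonneg[OF \<omega> t]]
      by (simp only: mult_minus_left mult_minus_right mult.commute)
  qed
  also have "\<dots> = ennreal (exp (- t * \<Phi> (\<psi> \<mu>)))"
    using \<psi>(2)[OF \<mu>] t by (intro has_laplace_exponentD_nn_integral[OF \<Phi>])
  finally show "(\<integral>\<^sup>+\<omega>. ennreal (exp (- \<mu> * W t \<omega>)) \<partial>M) = ennreal (exp (- t * \<Phi> (\<psi> \<mu>)))" .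
qed (rule W_measurable)

lemma mono_subordinated:
  assumes "\<omega> \<in> space M"
  shows "mono_on {0..} (\<lambda>t. W t \<omega>)"
  using assms by (intro mono_onI S_le T_le) (auto intro: T_nonneg)

lemma right_continuous_subordinated:
  assumes \<omega>: "\<omega> \<in> space M" and t: "0 \<le> t"
  shows "continuous (at_right t) (\<lambda>u. W u \<omega>)"
proof -
  have T: "((\<lambda>u. T u \<omega>) \<longlongrightarrow> T t \<omega>) (at_right t)"
    using T_rc[OF \<omega> t] by (simp add: continuous_within)
  have "eventually (\<lambda>u. T u \<omega> \<in> {T t \<omega>..}) (at_right t)"
    using eventually_at_right_less[of t] by eventually_elim (simp add: T_le \<omega> t)
  \<comment> \<open>\<open>T\<close> may stay constant just after \<open>t\<close>, so its values
    approach \<open>T t\<close> within the closed half-line only. The filter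
    \<open>at a within A\<close> ignores \<open>a\<close> itself, so right-continuity of
    \<open>S\<close> covers this case.\<close>
  moreover have "at_right a = at a within {a..}" for a :: real
    unfolding at_within_def by (intro arg_cong[where f="\<lambda>A. inf (nhds a) (principal A)"]) auto
  then have "continuous (at (T t \<omega>) within {T t \<omega>..}) (\<lambda>s. S s \<omega>)"
    using S_rc[OF \<omega> T_nonneg[OF \<omega> t]] by simp
  ultimately have "((\<lambda>u. W u \<omega>) \<longlongrightarrow> W t \<omega>) (at_right t)"
    using continuous_within_tendsto_compose[where f="\<lambda>s. S s \<omega>" and x="\<lambda>u. T u \<omega>"] T by blast
  then show ?thesis by (simp add: continuous_within)
qed

section \<open>The Levy measure as a mixture of the laws of \<open>S t\<close>\<close>

text \<open>The Levy density of the tempered stable subordinator with tempering parameter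
  \<open>a\<close>.\<close>

definition levy_density :: "real \<Rightarrow> real \<Rightarrow> real \<Rightarrow> ennreal" where
  "levy_density a \<beta> t = ennreal (exp (- a * t)) *
     ennreal (\<beta> * t powr (- (1 + \<beta>)) / Gamma (1 - \<beta>)) * indicator {0<..} t"

text \<open>As a pushforward the mixture is a measure by construction, and integrals against it
  reduce to Tonelli.\<close>

definition levy_mixture :: "real \<Rightarrow> real \<Rightarrow> real measure" where
  "levy_mixture a \<beta> = distr (density lborel (levy_density a \<beta>) \<Otimes>\<^sub>M M) borel
     (\<lambda>p. S (max 0 (fst p)) (snd p))"

lemma levy_density_measurable [measurable]: "levy_density a \<beta> \<in> borel_measurable borel"
  unfolding levy_density_def by measurable

lemma sets_levy_mixture [simp]: "sets (levy_mixture a \<beta>) = sets borel"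
  by (simp add: levy_mixture_def)

lemma nn_integral_levy_mixture:
  assumes h: "h \<in> borel_measurable borel"
  shows "(\<integral>\<^sup>+x. h x \<partial>levy_mixture a \<beta>) =
    (\<integral>\<^sup>+t. levy_density a \<beta> t * (\<integral>\<^sup>+\<omega>. h (S t \<omega>) \<partial>M) \<partial>lborel)"
proof -
  have J: "(\<lambda>p. S (max 0 (fst p)) (snd p)) \<in> borel_measurable (density lborel (levy_density a \<beta>) \<Otimes>\<^sub>M M)"
    using S_joint(2) by (simp cong: measurable_cong_sets)
  have hS: "(\<lambda>p. h (S (max 0 (fst p)) (snd p))) \<in> borel_measurable (borel \<Otimes>\<^sub>M M)"
    by (rule measurable_compose[OF S_joint(2) h])
  have "(\<integral>\<^sup>+x. h x \<partial>levy_mixture a \<beta>) =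
      (\<integral>\<^sup>+p. h (S (max 0 (fst p)) (snd p)) \<partial>(density lborel (levy_density a \<beta>) \<Otimes>\<^sub>M M))"
    unfolding levy_mixture_def using h by (subst nn_integral_distr[OF J]) auto
  also have "\<dots> = (\<integral>\<^sup>+t. \<integral>\<^sup>+\<omega>. h (S (max 0 t) \<omega>) \<partial>M \<partial>density lborel (levy_density a \<beta>))"
    using measurable_compose[OF J h] by (subst nn_integral_fst[symmetric]) auto
  also have "\<dots> = (\<integral>\<^sup>+t. levy_density a \<beta> t * (\<integral>\<^sup>+\<omega>. h (S (max 0 t) \<omega>) \<partial>M) \<partial>lborel)"
    using borel_measurable_nn_integral_fst[OF hS] by (subst nn_integral_density) auto
  also have "\<dots> = (\<integral>\<^sup>+t. levy_density a \<beta> t * (\<integral>\<^sup>+\<omega>. h (S t \<omega>) \<partial>M) \<partial>lborel)"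
  proof (rule nn_integral_cong)
    fix t :: real
    show "levy_density a \<beta> t * (\<integral>\<^sup>+\<omega>. h (S (max 0 t) \<omega>) \<partial>M) =
        levy_density a \<beta> t * (\<integral>\<^sup>+\<omega>. h (S t \<omega>) \<partial>M)"
      by (cases "0 < t") (auto simp: levy_density_def max_absorb2)
  qed
  finally show ?thesis .
qed

lemma emeasure_levy_mixture:
  assumes A: "A \<in> sets borel"
  shows "emeasure (levy_mixture a \<beta>) A =
    (\<integral>\<^sup>+t\<in>{0<..}. ennreal (exp (- a * t)) * emeasure M {\<omega> \<in> space M. S t \<omega> \<in> A} *
      ennreal (\<beta> * t powr (- (1 + \<beta>)) / Gamma (1 - \<beta>)) \<partial>lborel)"
proof -
  have "emeasure (levy_mixture a \<beta>) A = (\<integral>\<^sup>+x. indicator A x \<partial>levy_mixture a \<beta>)"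
    using A by (subst nn_integral_indicator) auto
  also have "\<dots> = (\<integral>\<^sup>+t. levy_density a \<beta> t * (\<integral>\<^sup>+\<omega>. indicator A (S t \<omega>) \<partial>M) \<partial>lborel)"
    using A by (intro nn_integral_levy_mixture) auto
  also have "\<dots> = (\<integral>\<^sup>+t\<in>{0<..}. ennreal (exp (- a * t)) * emeasure M {\<omega> \<in> space M. S t \<omega> \<in> A} *
      ennreal (\<beta> * t powr (- (1 + \<beta>)) / Gamma (1 - \<beta>)) \<partial>lborel)"
  proof (rule nn_integral_cong)
    fix t :: real
    note A[measurable]
    have "(\<integral>\<^sup>+\<omega>. indicator A (S t \<omega>) \<partial>M) = emeasure M {\<omega> \<in> space M. S t \<omega> \<in> A}" if t: "0 < t"
    proof -
      have [measurable]: "S t \<in> borel_measurable M" using t by (simp add: S_measurable_M)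
      have "(\<integral>\<^sup>+\<omega>. indicator A (S t \<omega>) \<partial>M) = (\<integral>\<^sup>+\<omega>. indicator {\<omega> \<in> space M. S t \<omega> \<in> A} \<omega> \<partial>M)"
        by (intro nn_integral_cong) (auto simp: indicator_def)
      also have "\<dots> = emeasure M {\<omega> \<in> space M. S t \<omega> \<in> A}"
        by (intro nn_integral_indicator) measurable
      finally show ?thesis .
    qed
    then show "levy_density a \<beta> t * (\<integral>\<^sup>+\<omega>. indicator A (S t \<omega>) \<partial>M) =
        ennreal (exp (- a * t)) * emeasure M {\<omega> \<in> space M. S t \<omega> \<in> A} *
        ennreal (\<beta> * t powr (- (1 + \<beta>)) / Gamma (1 - \<beta>)) * indicator {0<..} t"
      by (cases "0 < t") (auto simp: levy_density_def ac_simps)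
  qed
  finally show ?thesis .
qed

text \<open>On the event \<open>S t \<le> 0\<close> the variable \<open>exp (- \<mu> * S t)\<close>
  is at least 1, so the Laplace transform bounds its probability; then \<open>\<mu>\<close> tends to
  infinity. Hence the mixture has no mass on \<open>{..0}\<close>.\<close>

lemma emeasure_nonpos_eq_0:
  assumes \<psi>: "has_laplace_exponent M S \<psi>" "filterlim \<psi> at_top at_top" and t: "0 < t"
  shows "emeasure M {\<omega> \<in> space M. S t \<omega> \<in> {..0}} = 0"
proof -
  have [measurable]: "S t \<in> borel_measurable M" using t by (simp add: S_measurable_M)
  have le: "emeasure M {\<omega> \<in> space M. S t \<omega> \<in> {..0}} \<le> ennreal (exp (- t * \<psi> \<mu>))" if \<mu>: "0 \<le> \<mu>" for \<mu>
  proof -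
    have "emeasure M {\<omega> \<in> space M. S t \<omega> \<in> {..0}} = (\<integral>\<^sup>+\<omega>. indicator {\<omega> \<in> space M. S t \<omega> \<in> {..0}} \<omega> \<partial>M)"
      by (rule nn_integral_indicator[symmetric]) measurable
    also have "\<dots> \<le> (\<integral>\<^sup>+\<omega>. ennreal (exp (- \<mu> * S t \<omega>)) \<partial>M)"
      using \<mu> by (intro nn_integral_mono) (auto simp: indicator_def mult_nonneg_nonpos)
    also have "\<dots> = ennreal (exp (- t * \<psi> \<mu>))"
      using t \<mu> by (intro has_laplace_exponentD_nn_integral[OF \<psi>(1)]) auto
    finally show ?thesis .
  qed
  have "filterlim (\<lambda>\<mu>. t * \<psi> \<mu>) at_top at_top"
    using t by (intro filterlim_tendsto_pos_mult_at_top[OF tendsto_const _ \<psi>(2)])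
  then have "((\<lambda>\<mu>. exp (- (t * \<psi> \<mu>))) \<longlongrightarrow> 0) at_top"
    by (intro filterlim_compose[OF exp_at_bot] filterlim_compose[OF filterlim_uminus_at_bot_at_top])
  then have "((\<lambda>\<mu>. ennreal (exp (- t * \<psi> \<mu>))) \<longlongrightarrow> ennreal 0) at_top"
    by (intro tendsto_ennrealI) simp
  then have "emeasure M {\<omega> \<in> space M. S t \<omega> \<in> {..0}} \<le> ennreal 0"
    by (rule tendsto_lowerbound)
      (use le in \<open>auto intro!: eventually_mono[OF eventually_ge_at_top[of 0]]\<close>)
  then show ?thesis by simp
qed

lemma is_levy_measure_levy_mixture:
  assumes a: "0 < a" and \<beta>: "0 < \<beta>" "\<beta> < 1"
    and \<psi>: "has_laplace_exponent M S \<psi>" "\<And>\<mu>. 0 \<le> \<mu> \<Longrightarrow> 0 \<le> \<psi> \<mu>" "filterlim \<psi> at_top at_top"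
    and T: "has_laplace_exponent M T (\<lambda>\<mu>. (a + \<mu>) powr \<beta> - a powr \<beta>)"
  shows "is_levy_measure M W (levy_mixture a \<beta>)"
proof -
  let ?m = "levy_mixture a \<beta>"
  have neg: "emeasure ?m {..0} = 0"
  proof -
    have "emeasure ?m {..0} = (\<integral>\<^sup>+t. 0 \<partial>(lborel :: real measure))"
      unfolding emeasure_levy_mixture[OF borel_closed[OF closed_atMost]]
      by (intro nn_integral_cong)
        (metis (no_types, lifting) emeasure_nonpos_eq_0[OF \<psi>(1,3)] greaterThan_iff
          indicator_simps(2) mult_zero_left mult_zero_right)
    then show ?thesis by simp
  qed
  \<comment> \<open>Positivity almost everywhere serves the moment bound and gives
    \<open>1 - exp (- \<mu> * x)\<close> the sign needed to read its Bochner integral off the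
    nonnegative one.\<close>
  have pos: "AE x in ?m. 0 < x"
    by (rule AE_I[OF _ neg]) (auto simp: levy_mixture_def)
  have exponent: "(\<integral>\<^sup>+x. ennreal (1 - exp (- \<mu> * x)) \<partial>?m) = ennreal ((a + \<psi> \<mu>) powr \<beta> - a powr \<beta>)"
    if \<mu>: "0 \<le> \<mu>" for \<mu>
  proof -
    have "(\<integral>\<^sup>+x. ennreal (1 - exp (- \<mu> * x)) \<partial>?m) =
        (\<integral>\<^sup>+t. levy_density a \<beta> t * (\<integral>\<^sup>+\<omega>. ennreal (1 - exp (- \<mu> * S t \<omega>)) \<partial>M) \<partial>lborel)"
      by (rule nn_integral_levy_mixture) measurable
    also have "\<dots> = (\<integral>\<^sup>+t\<in>{0<..}. ennreal (exp (- a * t) * (1 - exp (- \<psi> \<mu> * t)) *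
        (\<beta> * t powr (- (1 + \<beta>)) / Gamma (1 - \<beta>))) \<partial>lborel)"
    proof (rule nn_integral_cong)
      fix t :: real
      show "levy_density a \<beta> t * (\<integral>\<^sup>+\<omega>. ennreal (1 - exp (- \<mu> * S t \<omega>)) \<partial>M) =
          ennreal (exp (- a * t) * (1 - exp (- \<psi> \<mu> * t)) *
            (\<beta> * t powr (- (1 + \<beta>)) / Gamma (1 - \<beta>))) * indicator {0<..} t"
      proof (cases "0 < t")
        case True
        then have [measurable]: "S t \<in> borel_measurable M" by (simp add: S_measurable_M)
        have le1: "exp (- \<mu> * S t \<omega>) \<le> 1" if "\<omega> \<in> space M" for \<omega>
          using that True \<mu> S_nonneg[of \<omega> t] by auto
        have L: "(\<integral>\<^sup>+\<omega>. ennreal (exp (- \<mu> * S t \<omega>)) \<partial>M) = ennreal (exp (- t * \<psi> \<mu>))"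
          using True \<mu> by (intro has_laplace_exponentD_nn_integral[OF \<psi>(1)]) auto
        have "(\<integral>\<^sup>+\<omega>. ennreal (1 - exp (- \<mu> * S t \<omega>)) \<partial>M) =
            (\<integral>\<^sup>+\<omega>. ennreal 1 - ennreal (exp (- \<mu> * S t \<omega>)) \<partial>M)"
          by (intro nn_integral_cong ennreal_minus[symmetric]) simp
        \<comment> \<open>Subtraction under the integral in \<open>ennreal\<close> needs a finite
          subtrahend, from \<open>L\<close>, and its domination by 1, from
          \<open>le1\<close>.\<close>
        also have "\<dots> = (\<integral>\<^sup>+\<omega>. ennreal 1 \<partial>M) - (\<integral>\<^sup>+\<omega>. ennreal (exp (- \<mu> * S t \<omega>)) \<partial>M)"
          using L le1 by (intro nn_integral_diff) (auto intro!: AE_I2)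
        also have "\<dots> = ennreal (1 - exp (- \<psi> \<mu> * t))"
        proof -
          have "(\<integral>\<^sup>+\<omega>. ennreal 1 \<partial>M) = ennreal 1" by (simp add: emeasure_space_1)
          then show ?thesis
            by (simp only: L)
              (simp only: ennreal_minus exp_ge_zero mult_minus_left mult_minus_right mult.commute)
        qed
        finally show ?thesis
          using True \<psi>(2)[OF \<mu>] \<beta> Gamma_real_pos[of "1 - \<beta>"]
          by (simp add: levy_density_def ennreal_mult'[symmetric] ac_simps)
      qed (simp add: levy_density_def)
    qed
    also have "\<dots> = ennreal ((a + \<psi> \<mu>) powr \<beta> - a powr \<beta>)"
      by (rule tempered_stable_exponent[OF a \<beta> \<psi>(2)[OF \<mu>]])
    finally show ?thesis .
  qed
  \<comment> \<open>The moment condition comes from the exponent at \<open>\<mu> = 1\<close>: for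
    positive \<open>x\<close>, \<open>1 - exp (- x)\<close> is at least \<open>x / (1 + x)\<close>,
    which is at least half of \<open>min 1 x\<close>.\<close>
  have "(\<integral>\<^sup>+x. ennreal (min 1 x) \<partial>?m) \<le> (\<integral>\<^sup>+x. 2 * ennreal (1 - exp (- 1 * x)) \<partial>?m)"
  proof (rule nn_integral_mono_AE)
    show "AE x in ?m. ennreal (min 1 x) \<le> 2 * ennreal (1 - exp (- 1 * x))"
      using pos
    proof eventually_elim
      case (elim x)
      have "exp (- x) \<le> 1 / (1 + x)"
        using elim exp_ge_add_one_self[of x] by (simp add: exp_minus field_simps)
      moreover have "min 1 x \<le> 2 * (1 - 1 / (1 + x))"
        using elim by (auto simp: min_def field_simps)
      ultimately have "min 1 x \<le> 2 * (1 - exp (- 1 * x))" by simp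
      then have "ennreal (min 1 x) \<le> ennreal (2 * (1 - exp (- 1 * x)))" by (rule ennreal_leI)
      also have "\<dots> = ennreal 2 * ennreal (1 - exp (- 1 * x))" by (rule ennreal_mult') simp
      finally show ?case by (simp only: ennreal_numeral)
    qed
  qed
  also have "\<dots> = 2 * (\<integral>\<^sup>+x. ennreal (1 - exp (- 1 * x)) \<partial>?m)"
    by (rule nn_integral_cmult) (simp add: levy_mixture_def)
  also have "\<dots> < \<infinity>"
    using exponent[of 1] by (simp add: ennreal_mult_less_top)
  finally have fin: "(\<integral>\<^sup>+x. ennreal (min 1 x) \<partial>?m) < \<infinity>" .
  have int: "(\<integral>x. (1 - exp (- \<mu> * x)) \<partial>?m) = (a + \<psi> \<mu>) powr \<beta> - a powr \<beta>" if \<mu>: "0 \<le> \<mu>" for \<mu>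
  proof -
    have "(\<integral>x. (1 - exp (- \<mu> * x)) \<partial>?m) = enn2real (\<integral>\<^sup>+x. ennreal (1 - exp (- \<mu> * x)) \<partial>?m)"
    proof (rule integral_eq_nn_integral)
      show "AE x in ?m. 0 \<le> 1 - exp (- \<mu> * x)"
        using pos by eventually_elim (simp add: \<mu>)
    qed (simp add: levy_mixture_def)
    also have "\<dots> = (a + \<psi> \<mu>) powr \<beta> - a powr \<beta>"
      using a \<beta> \<psi>(2)[OF \<mu>] by (simp only: exponent[OF \<mu>]) (simp add: powr_mono2)
    finally show ?thesis .
  qed
  \<comment> \<open>The drift is 0, since the integral against the mixture already gives the whole
    composed exponent.\<close>
  have "has_laplace_exponent M W (\<lambda>\<mu>. 0 * \<mu> + (\<integral>x. (1 - exp (- \<mu> * x)) \<partial>?m))"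
    using has_laplace_exponent_subordinated[OF \<psi>(1,2) T]
    by (simp add: has_laplace_exponent_def int[simplified])
  with neg fin show ?thesis
    unfolding is_levy_measure_def by (intro conjI exI[of _ 0]) simp_all
qed

end

section \<open>Adaptedness and assembly of the subordinators\<close>

text \<open>The left limit at \<open>t\<close> is the supremum over times in \<open>(0, t)\<close>,
  bounded by the value at \<open>t\<close>; positive times are used because monotonicity is assumed
  on \<open>{0..}\<close>. This admits \<open>S\<close> among the processes of
  \<open>sigma_at\<close>.\<close>

lemma cadlag_on_increasing:
  assumes mono: "\<And>\<omega>. \<omega> \<in> \<Omega> \<Longrightarrow> mono_on {0..} (\<lambda>t. X t \<omega>)"
    and rc: "\<And>\<omega> t. \<omega> \<in> \<Omega> \<Longrightarrow> 0 \<le> t \<Longrightarrow> continuous (at_right t) (\<lambda>u. X u \<omega>)"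
  shows "cadlag_on \<Omega> X"
  unfolding cadlag_on_def
proof (intro ballI conjI allI impI)
  fix \<omega> and t :: real assume \<omega>: "\<omega> \<in> \<Omega>" and t: "0 < t"
  have le: "X a \<omega> \<le> X b \<omega>" if "0 \<le> a" "a \<le> b" for a b
    using mono[OF \<omega>] that by (auto simp: mono_on_def)
  have "((\<lambda>u. X u \<omega>) \<longlongrightarrow> Sup ((\<lambda>u. X u \<omega>) ` ({..<t} \<inter> {0<..}))) (at t within ({..<t} \<inter> {0<..}))"
    by (rule Lim_left_bound[where K="X t \<omega>"]) (auto intro: le)
  moreover have "at t within ({..<t} \<inter> {0<..}) = at_left t"
    using t by (intro at_within_nhd[of _ "{0<..}"]) auto
  ultimately show "\<exists>l. ((\<lambda>u. X u \<omega>) \<longlongrightarrow> l) (at_left t)" by auto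
qed (rule rc)

lemma (in prob_space) subordinator_sum:
  fixes X :: "'i \<Rightarrow> real \<Rightarrow> 'a \<Rightarrow> real"
  assumes I: "finite I" and c: "\<And>i. i \<in> I \<Longrightarrow> 0 \<le> c i"
    and ind: "indep_vars (\<lambda>_. path_space) (\<lambda>i. path_of (X i)) I"
    and X: "\<And>i. i \<in> I \<Longrightarrow> subordinator M F (X i)"
  shows "subordinator M F (\<lambda>t \<omega>. \<Sum>i\<in>I. c i * X i t \<omega>)"
  unfolding subordinator_def
proof (intro conjI ballI allI impI)
  show "adapted F (\<lambda>t \<omega>. \<Sum>i\<in>I. c i * X i t \<omega>)"
    using X by (auto simp: adapted_def subordinator_def intro!: borel_measurable_sum borel_measurable_times)
  show "independent_increments M (\<lambda>t \<omega>. \<Sum>i\<in>I. c i * X i t \<omega>)"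
    using X by (intro independent_increments_sum I ind) (simp add: subordinator_def)
  show "stationary_increments M (\<lambda>t \<omega>. \<Sum>i\<in>I. c i * X i t \<omega>)"
    using X by (intro stationary_increments_sum ind) (simp add: subordinator_def)
  fix \<omega> assume \<omega>: "\<omega> \<in> space M"
  show "(\<Sum>i\<in>I. c i * X i 0 \<omega>) = 0"
    using X \<omega> by (intro sum.neutral) (simp add: subordinator_def)
  show "mono_on {0..} (\<lambda>t. \<Sum>i\<in>I. c i * X i t \<omega>)"
  proof (rule mono_onI)
    fix s t :: real assume "s \<in> {0..}" "t \<in> {0..}" "s \<le> t"
    then show "(\<Sum>i\<in>I. c i * X i s \<omega>) \<le> (\<Sum>i\<in>I. c i * X i t \<omega>)"
      using X \<omega> c by (intro sum_mono mult_left_mono) (auto simp: subordinator_def mono_on_def)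
  qed
  show "continuous (at_right t) (\<lambda>u. \<Sum>i\<in>I. c i * X i u \<omega>)" if "0 \<le> t" for t
    using X \<omega> that by (intro continuous_intros) (simp add: subordinator_def)
qed

context subordination
begin

text \<open>\<open>S\<close> is itself one of the adapted cadlag processes that generate
  \<open>sigma_at\<close>, so every event of \<open>W t\<close> is a generator of the
  \<sigma>-algebra at \<open>T t\<close>.\<close>

lemma adapted_sigma_at:
  assumes S: "adapted F S"
  shows "adapted (\<lambda>t. sigma_at M F (T t)) W"
  unfolding adapted_def
proof (intro allI impI measurableI)
  fix t :: real and B :: "real set" assume B: "B \<in> sets borel"
  have space: "space (sigma_at M F (T t)) = space M"
    unfolding sigma_at_def by (rule space_measure_of) auto
  have "cadlag_on (space M) S"
    by (rule cadlag_on_increasing) (fact S_mono S_rc)+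
  then have "W t -` B \<inter> space M \<in> {(\<lambda>\<omega>. X (T t \<omega>) \<omega>) -` B \<inter> space M | X B.
      adapted F X \<and> cadlag_on (space M) X \<and> B \<in> sets borel}"
    using S B by blast
  then show "W t -` B \<inter> space (sigma_at M F (T t)) \<in> sets (sigma_at M F (T t))"
    unfolding space unfolding sigma_at_def by (subst sets_measure_of) (auto intro: sigma_sets.Basic)
qed simp

lemma subordinator_subordinated:
  assumes "adapted F S"
  shows "subordinator M (\<lambda>t. sigma_at M F (T t)) W"
  unfolding subordinator_def
  using adapted_sigma_at[OF assms] mono_subordinated right_continuous_subordinated
    independent_increments_subordinated stationary_increments_subordinated
  by (simp add: T_0 S_0)

end

section \<open>Specialization to the combination of stable subordinators\<close>

lemma filterlim_powr_at_top:
  fixes c \<beta> :: real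
  assumes c: "0 < c" and \<beta>: "0 < \<beta>"
  shows "filterlim (\<lambda>\<mu>. (\<mu> * c) powr \<beta>) at_top at_top"
proof -
  have "filterlim (\<lambda>\<mu>. exp (\<beta> * ln (c * \<mu>))) at_top at_top"
    using c \<beta>
    by (intro filterlim_compose[OF exp_at_top] filterlim_tendsto_pos_mult_at_top[OF tendsto_const]
      filterlim_compose[OF ln_at_top] filterlim_ident)
  moreover have "\<forall>\<^sub>F \<mu> in at_top. exp (\<beta> * ln (c * \<mu>)) = (\<mu> * c) powr \<beta>"
    using eventually_gt_at_top[of 0] by eventually_elim (use c in \<open>simp add: powr_def mult.commute\<close>)
  ultimately show ?thesis by (simp cong: filterlim_cong)
qed

lemma measurable_path_vimage_algebra:
  fixes X :: "real \<Rightarrow> 'a \<Rightarrow> real"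
  assumes t: "0 \<le> t"
  shows "X t \<in> borel_measurable (vimage_algebra \<Omega> (path_of X) path_space)"
proof -
  have "path_of X \<in> vimage_algebra \<Omega> (path_of X) path_space \<rightarrow>\<^sub>M path_space"
    by (rule measurable_vimage_algebra1) (auto simp: path_of_def space_PiM)
  from measurable_compose[OF this measurable_component_singleton[of t "{0..}"]] t
  show ?thesis by (simp add: path_of_def)
qed

lemma measurable_paths_vimage_algebra:
  fixes X :: "'i \<Rightarrow> real \<Rightarrow> 'a \<Rightarrow> real"
  assumes i: "i \<in> I" and t: "0 \<le> t"
  shows "X i t \<in> borel_measurable
    (vimage_algebra \<Omega> (\<lambda>\<omega>. \<lambda>i\<in>I. path_of (X i) \<omega>) (PiM I (\<lambda>_. path_space)))"
proof -
  have "(\<lambda>\<omega>. \<lambda>i\<in>I. path_of (X i) \<omega>) \<in>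
      vimage_algebra \<Omega> (\<lambda>\<omega>. \<lambda>i\<in>I. path_of (X i) \<omega>) (PiM I (\<lambda>_. path_space)) \<rightarrow>\<^sub>M
      PiM I (\<lambda>_. path_space)"
    by (rule measurable_vimage_algebra1) (auto simp: path_of_def space_PiM)
  from measurable_compose[OF measurable_compose[OF this measurable_component_singleton[OF i]]
      measurable_component_singleton[of t "{0..}"]] t i
  show ?thesis by (simp add: path_of_def)
qed

text \<open>The Levy measure is asserted for \<open>\<delta> < real n\<close>. For an integer
  \<open>\<delta>\<close> one has \<open>\<delta> = n\<close>: the exponent of \<open>T\<close> is
  then \<open>\<mu>\<close>, a pure drift, and \<open>Gamma (1 - \<delta> / real n)\<close> sits at
  the pole 0, so the density has no meaning.\<close>

theorem theorem2p1:
  fixes M :: "'a measure" and F :: "real \<Rightarrow> 'a measure"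
    and \<delta> \<eta> \<nu> :: real and n :: nat
    and V :: "nat \<Rightarrow> real \<Rightarrow> 'a \<Rightarrow> real" and T :: "real \<Rightarrow> 'a \<Rightarrow> real"
  assumes space: "filtered_prob_space M F"
    and \<delta>: "0 < \<delta>" and \<eta>: "0 < \<eta>" and n: "int n = \<lceil>\<delta>\<rceil>"
    and \<nu>: "\<nu> \<in> {0<..<1}" "\<And>r. r \<in> {1..n} \<Longrightarrow> \<nu> * real r \<in> {0<..<1}"
    and V: "\<And>r. r \<in> {1..n} \<Longrightarrow> stable_subordinator M F (\<nu> * real r) (V r)"
    and V_indep: "prob_space.indep_vars M (\<lambda>_. path_space) (\<lambda>r. path_of (V r)) {1..n}"
    and T: "subordinator M F T"
      "has_laplace_exponent M T (\<lambda>\<mu>. (\<eta> ^ n + \<mu>) powr (\<delta> / real n) - \<eta> powr \<delta>)"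
    and T_indep: "prob_space.indep_set M
      (sets (vimage_algebra (space M) (path_of T) path_space))
      (sets (vimage_algebra (space M) (\<lambda>\<omega>. \<lambda>r\<in>{1..n}. path_of (V r) \<omega>)
        (PiM {1..n} (\<lambda>_. path_space))))"
  shows "subordinator M (\<lambda>t. sigma_at M F (T t))
      (\<lambda>t \<omega>. stable_combination \<eta> \<nu> n V (T t \<omega>) \<omega>) \<and>
    (\<delta> < real n \<longrightarrow>
      (\<exists>m. is_levy_measure M (\<lambda>t \<omega>. stable_combination \<eta> \<nu> n V (T t \<omega>) \<omega>) m \<and>
        (\<forall>A\<in>sets borel. emeasure m A =
          (\<integral>\<^sup>+t\<in>{0<..}. ennreal (exp (- (\<eta> ^ n) * t))
             * emeasure M {\<omega> \<in> space M. stable_combination \<eta> \<nu> n V t \<omega> \<in> A}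
             * ennreal (\<delta> / real n * t powr (- (1 + \<delta> / real n)) / Gamma (1 - \<delta> / real n))
           \<partial>lborel))))"
proof -
  interpret prob_space M
    using space by (simp add: filtered_prob_space_def)
  define c where "c r = real (n choose r) powr (1 / (\<nu> * real r)) *
      \<eta> powr ((real n - real r) / (\<nu> * real r))" for r
  define S where "S t \<omega> = (\<Sum>r\<in>{1..n}. c r * V r t \<omega>)" for t \<omega>
  \<comment> \<open>For \<open>\<mu> \<ge> 0\<close> the choice of \<open>c\<close> makes this sum
    equal to \<open>(\<eta> + \<mu> powr \<nu>) ^ n - \<eta> ^ n\<close>, by the binomial theorem.
    The proof works from its nonnegativity and its divergence.\<close>
  define \<psi> where "\<psi> \<mu> = (\<Sum>r\<in>{1..n}. (\<mu> * c r) powr (\<nu> * real r))" for \<mu>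
  have S_eq: "stable_combination \<eta> \<nu> n V = S"
    by (intro ext) (simp add: stable_combination_def S_def c_def)
  have n1: "1 \<le> n" using \<delta> n by linarith
  have c: "0 < c r" if "r \<in> {1..n}" for r
    using that \<eta> by (simp add: c_def)
  have V_sub: "subordinator M F (V r)" if "r \<in> {1..n}" for r
    using V[OF that] by (simp add: stable_subordinator_def)
  have S: "subordinator M F S"
    unfolding S_def using c by (intro subordinator_sum V_indep V_sub) (auto intro: less_imp_le)
  have S_laplace: "has_laplace_exponent M S \<psi>"
    unfolding S_def \<psi>_def
    by (rule has_laplace_exponent_sum[OF _ _ V_indep])
      (use V c in \<open>auto simp: stable_subordinator_def intro: less_imp_le\<close>)
  \<comment> \<open>The two sub-\<sigma>-algebras are generated by the paths of all
    \<open>V r\<close> jointly and by the path of \<open>T\<close>, so their independence is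
    \<open>T_indep\<close>; \<open>S\<close> is measurable for the first as a finite combination of
    the \<open>V r\<close>.\<close>
  interpret subordination M
      "vimage_algebra (space M) (\<lambda>\<omega>. \<lambda>r\<in>{1..n}. path_of (V r) \<omega>) (PiM {1..n} (\<lambda>_. path_space))"
      "vimage_algebra (space M) (path_of T) path_space" S T
  proof
    show "S t \<in> borel_measurable
        (vimage_algebra (space M) (\<lambda>\<omega>. \<lambda>r\<in>{1..n}. path_of (V r) \<omega>) (PiM {1..n} (\<lambda>_. path_space)))"
      if "0 \<le> t" for t
      unfolding S_def
      by (intro borel_measurable_sum borel_measurable_times borel_measurable_const
        measurable_paths_vimage_algebra that)
  qed (use S T(1) T_indep in \<open>auto simp: subordinator_def measurable_path_vimage_algebra\<close>)
  have sub: "subordinator M (\<lambda>t. sigma_at M F (T t)) (\<lambda>t \<omega>. S (T t \<omega>) \<omega>)"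
    using S by (intro subordinator_subordinated) (simp add: subordinator_def)
  have levy: "is_levy_measure M (\<lambda>t \<omega>. S (T t \<omega>) \<omega>) (levy_mixture (\<eta> ^ n) (\<delta> / real n))" if "\<delta> < real n"
  proof (rule is_levy_measure_levy_mixture[OF _ _ _ S_laplace])
    show "0 < \<eta> ^ n" "0 < \<delta> / real n" "\<delta> / real n < 1" using \<eta> \<delta> n1 that by auto
    show "0 \<le> \<psi> \<mu>" for \<mu> unfolding \<psi>_def by (intro sum_nonneg) simp
    \<comment> \<open>The summand \<open>r = 1\<close>, present because \<open>n \<ge> 1\<close>,
      already forces divergence: all summands are nonnegative.\<close>
    have "filterlim (\<lambda>\<mu>. (\<mu> * c 1) powr \<nu>) at_top at_top"
      using c[of 1] \<nu>(1) n1 by (intro filterlim_powr_at_top) auto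
    moreover have "(\<mu> * c 1) powr \<nu> \<le> \<psi> \<mu>" for \<mu>
      using n1 member_le_sum[of 1 "{1..n}" "\<lambda>r. (\<mu> * c r) powr (\<nu> * real r)"] by (simp add: \<psi>_def)
    ultimately show "filterlim \<psi> at_top at_top"
      by (auto intro: filterlim_at_top_mono)
    have "(\<eta> ^ n) powr (\<delta> / real n) = \<eta> powr \<delta>"
      using \<eta> n1 by (simp add: powr_realpow[symmetric] powr_powr)
    then show "has_laplace_exponent M T (\<lambda>\<mu>. (\<eta> ^ n + \<mu>) powr (\<delta> / real n) - (\<eta> ^ n) powr (\<delta> / real n))"
      using T(2) by simp
  qed
  show ?thesis
    unfolding S_eq
    by (intro conjI sub impI exI[of _ "levy_mixture (\<eta> ^ n) (\<delta> / real n)"] levy ballI emeasure_levy_mixture)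
qed

end
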